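(* Let $M=G/H$ be a homogeneous manifold with a reductive decomposition $\mathfrak g=\mathfrak h+\mathfrak m$, and let $F$ be a $G$-invariant $(\alpha_1,\alpha_2)$-metric on $M$ defined by a $G$-invariant Riemannian metric $g$ on $M$, $\alpha=\sqrt{g(\cdot,\cdot)}$, with corresponding $\mathrm{Ad}(H)$-invariant $g$-orthogonal decomposition $\mathfrak m=\mathfrak m_1+\mathfrak m_2$. If $(M,g)$ is naturally reductive (with respect to $\mathfrak g=\mathfrak h+\mathfrak m$) and $\mathfrak g'=[\mathfrak g,\mathfrak g]\subseteq \mathfrak h+\mathfrak m_1$, then $(M,F)$ is also naturally reductive.
   Context: $G$ is a Lie group with Lie algebra $\mathfrak g$, $H$ a closed subgroup with Lie algebra $\mathfrak h$; a reductive decomposition is an $\mathrm{Ad}(H)$-invariant vector space decomposition $\mathfrak g=\mathfrak h+\mathfrak m$ (direct sum), and $\mathfrak m$ is identified with $T_o(G/H)$, $o=eH$. A subscript $\mathfrak m$ (or $\mathfrak m_i$) denotes the $\mathfrak m$- (or $\mathfrak m_i$-) component of a vector of $\mathfrak g$. $(\alpha_1,\alpha_2)$-metric: a Finsler metric $F$ on $M$ (smooth and strongly convex on $TM\setminus\{0\}$) for which there are a Riemannian metric $\alpha$ (written as a norm) and an $\alpha$-orthogonal bundle decomposition $TM=\mathcal V_1\oplus\mathcal V_2$ such that for $y=y_1+y_2\in T_xM$, $y_i\in\mathcal V_i$, one has $F(x,y)=f(\alpha(x,y_1),\alpha(x,y_2))$ for a positive smooth function $f$ of two variables. Equivalently $F=\alpha\,\phi(\alpha_2/\alpha)$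 with $\phi$ a positive smooth function and $\alpha_i(y)=\alpha(y_i)$. In the homogeneous setting, $F$, $\alpha$ and the decomposition are $G$-invariant, so $\alpha$ is given by an $\mathrm{Ad}(H)$-invariant inner product $\langle\cdot,\cdot\rangle$ on $\mathfrak m$, and $\mathcal V_1,\mathcal V_2$ by an $\mathrm{Ad}(H)$-invariant $\langle\cdot,\cdot\rangle$-orthogonal decomposition $\mathfrak m=\mathfrak m_1+\mathfrak m_2$. Fundamental tensor and Cartan tensor: for $y\neq0$, $g_y(u,v)=\frac12\frac{\partial^2}{\partial s\partial t}F^2(y+su+tv)\big|_{s=t=0}$ and $C_y(u,v,w)=\frac14\frac{\partial^3}{\partial r\partial s\partial t}F^2(y+ru+sv+tw)\big|_{r=s=t=0}$. Naturally reductive, Riemannian: $(G/H,g)$ is naturally reductive with respect to $\mathfrak g=\mathfrak h+\mathfrak m$ if $\langle[z,u]_{\mathfrak m},v\rangle+\langle u,[z,v]_{\mathfrak m}\rangle=0$ for all $z,u,v\in\mathfrak m$. Naturally reductive, Finsler: $(G/H,F)$ with $F$ invariant is naturally reductive if there is an $\mathrm{Ad}(H)$-invariant decomposition $\mathfrak g=\mathfrak h+\mathfrak m$ such that $g_y(u,[z,x]_{\mathfrak m})+g_y([z,u]_{\mathfrak m},x)+2C_y([z,y]_{\mathfrak m},u,x)=0$ for all $0\neq y\in\mathfrak m$ and $u,x,z\in\mathfrak m$. *)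

theory Defs
  imports "HOL-Analysis.Analysis" "HOL-Algebra.Left_Coset"
begin

section \<open>Smooth maps between open subsets of Euclidean spaces\<close>

text \<open>All iterated directional derivatives exist as Frechet derivatives and are continuous.
  Only meaningful for open \<open>S\<close>.\<close>

primrec Ck_on :: "nat \<Rightarrow> 'a::real_normed_vector set \<Rightarrow> ('a \<Rightarrow> 'b::real_normed_vector) \<Rightarrow> bool" where
  "Ck_on 0 S f \<longleftrightarrow> continuous_on S f"
| "Ck_on (Suc k) S f \<longleftrightarrow>
     (\<forall>x\<in>S. f differentiable (at x)) \<and>
     (\<forall>v. Ck_on k S (\<lambda>x. frechet_derivative f (at x) v))"

definition smooth_on :: "'a::real_normed_vector set \<Rightarrow> ('a \<Rightarrow> 'b::real_normed_vector) \<Rightarrow> bool" where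
  "smooth_on S f \<longleftrightarrow> (\<forall>k. Ck_on k S f)"


section \<open>Smooth manifolds\<close>

type_synonym ('p, 'e) chart = "'p set \<times> ('p \<Rightarrow> 'e)"

text \<open>A chart is a pair of its domain and its coordinate map. The tangent space at \<open>p\<close> is modelled
  by the type \<open>'e\<close>, a tangent vector being given by its coordinates in the preferred chart
  \<open>chart_at X p\<close>; a function on the tangent bundle thus has type \<open>'p \<Rightarrow> 'e \<Rightarrow> _\<close>.\<close>

record ('p, 'e) charted_space =
  mtop :: "'p topology"
  atlas :: "('p, 'e) chart set"
  chart_at :: "'p \<Rightarrow> ('p, 'e) chart"

abbreviation chart_inv :: "('p, 'e) chart \<Rightarrow> 'e \<Rightarrow> 'p" where
  "chart_inv c \<equiv> inv_into (fst c) (snd c)"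

definition smooth_manifold :: "('p, 'e::euclidean_space) charted_space \<Rightarrow> bool" where
  "smooth_manifold X \<longleftrightarrow>
     Hausdorff_space (mtop X) \<and> second_countable (mtop X) \<and>
     (\<forall>c\<in>atlas X. openin (mtop X) (fst c) \<and> open (snd c ` fst c) \<and>
        homeomorphic_map (subtopology (mtop X) (fst c)) (top_of_set (snd c ` fst c)) (snd c)) \<and>
     (\<forall>c\<in>atlas X. \<forall>d\<in>atlas X. smooth_on (snd c ` (fst c \<inter> fst d)) (snd d \<circ> chart_inv c)) \<and>
     (\<forall>p\<in>topspace (mtop X). chart_at X p \<in> atlas X \<and> p \<in> fst (chart_at X p))"

definition prod_chart :: "('p, 'e) chart \<Rightarrow> ('q, 'f) chart \<Rightarrow> ('p \<times> 'q, 'e \<times> 'f) chart" where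
  "prod_chart c d = (fst c \<times> fst d, map_prod (snd c) (snd d))"

definition prod_manifold ::
    "('p, 'e) charted_space \<Rightarrow> ('q, 'f) charted_space \<Rightarrow> ('p \<times> 'q, 'e \<times> 'f) charted_space" where
  "prod_manifold X Y =
     \<lparr>mtop = prod_topology (mtop X) (mtop Y),
      atlas = {prod_chart c d |c d. c \<in> atlas X \<and> d \<in> atlas Y},
      chart_at = (\<lambda>(p, q). prod_chart (chart_at X p) (chart_at Y q))\<rparr>"

definition smooth_map ::
    "('p, 'e::euclidean_space) charted_space \<Rightarrow> ('q, 'f::euclidean_space) charted_space \<Rightarrow>
     ('p \<Rightarrow> 'q) \<Rightarrow> bool" where
  "smooth_map X Y f \<longleftrightarrow>
     continuous_map (mtop X) (mtop Y) f \<and>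
     (\<forall>c\<in>atlas X. \<forall>d\<in>atlas Y.
        smooth_on (snd c ` {p \<in> fst c. f p \<in> fst d}) (snd d \<circ> f \<circ> chart_inv c))"

definition tangent_map ::
    "('p, 'e::euclidean_space) charted_space \<Rightarrow> ('q, 'f::euclidean_space) charted_space \<Rightarrow>
     ('p \<Rightarrow> 'q) \<Rightarrow> 'p \<Rightarrow> 'e \<Rightarrow> 'f" where
  "tangent_map X Y f p v =
     frechet_derivative (snd (chart_at Y (f p)) \<circ> f \<circ> chart_inv (chart_at X p))
       (at (snd (chart_at X p) p)) v"

definition smooth_submersion ::
    "('p, 'e::euclidean_space) charted_space \<Rightarrow> ('q, 'f::euclidean_space) charted_space \<Rightarrow>
     ('p \<Rightarrow> 'q) \<Rightarrow> bool" where
  "smooth_submersion X Y f \<longleftrightarrow>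
     smooth_map X Y f \<and> (\<forall>p\<in>topspace (mtop X). range (tangent_map X Y f p) = UNIV)"

text \<open>Conversion between a tangent vector at \<open>p\<close> and its coordinates in a chart \<open>c\<close> around \<open>p\<close>.\<close>

definition to_coord ::
    "('p, 'e::euclidean_space) charted_space \<Rightarrow> ('p, 'e) chart \<Rightarrow> 'p \<Rightarrow> 'e \<Rightarrow> 'e" where
  "to_coord X c p v =
     frechet_derivative (snd c \<circ> chart_inv (chart_at X p)) (at (snd (chart_at X p) p)) v"

definition from_coord ::
    "('p, 'e::euclidean_space) charted_space \<Rightarrow> ('p, 'e) chart \<Rightarrow> 'p \<Rightarrow> 'e \<Rightarrow> 'e" where
  "from_coord X c p v =
     frechet_derivative (snd (chart_at X p) \<circ> chart_inv c) (at (snd c p)) v"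

definition vf_coord ::
    "('p, 'e::euclidean_space) charted_space \<Rightarrow> ('p, 'e) chart \<Rightarrow> ('p \<Rightarrow> 'e) \<Rightarrow> 'e \<Rightarrow> 'e" where
  "vf_coord X c V x = to_coord X c (chart_inv c x) (V (chart_inv c x))"

text \<open>The commutator \<open>[V, W]\<close> of vector fields at \<open>p\<close>, i.e. \<open>DW V - DV W\<close> in coordinates.\<close>

definition vf_bracket ::
    "('p, 'e::euclidean_space) charted_space \<Rightarrow> ('p \<Rightarrow> 'e) \<Rightarrow> ('p \<Rightarrow> 'e) \<Rightarrow> 'p \<Rightarrow> 'e" where
  "vf_bracket X V W p =
     (let c = chart_at X p in
        frechet_derivative (vf_coord X c W) (at (snd c p)) (V p)
        - frechet_derivative (vf_coord X c V) (at (snd c p)) (W p))"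

definition smooth_subbundle ::
    "('p, 'e::euclidean_space) charted_space \<Rightarrow> ('p \<Rightarrow> 'e set) \<Rightarrow> bool" where
  "smooth_subbundle X V \<longleftrightarrow>
     (\<forall>p\<in>topspace (mtop X). \<exists>c\<in>atlas X. p \<in> fst c \<and>
        (\<exists>W (n::nat) E. open W \<and> snd c p \<in> W \<and> W \<subseteq> snd c ` fst c \<and>
           (\<forall>i<n. smooth_on W (E i)) \<and>
           (\<forall>x\<in>W. inj_on (\<lambda>i. E i x) {..<n} \<and> independent ((\<lambda>i. E i x) ` {..<n}) \<and>
              V (chart_inv c x) =
                from_coord X c (chart_inv c x) ` span ((\<lambda>i. E i x) ` {..<n}))))"


section \<open>Lie groups and reductive homogeneous spaces\<close>

definition lie_group ::
    "('g, 'z) monoid_scheme \<Rightarrow> ('g, 'e::euclidean_space) charted_space \<Rightarrow> bool" where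
  "lie_group G X \<longleftrightarrow>
     group G \<and> smooth_manifold X \<and> topspace (mtop X) = carrier G \<and>
     smooth_map (prod_manifold X X) X (\<lambda>(a, b). a \<otimes>\<^bsub>G\<^esub> b) \<and>
     smooth_map X X (\<lambda>a. inv\<^bsub>G\<^esub> a)"

text \<open>The Lie algebra of \<open>G\<close> is the tangent space at the identity, i.e. the type \<open>'e\<close>.\<close>

definition left_invariant_field ::
    "('g, 'z) monoid_scheme \<Rightarrow> ('g, 'e::euclidean_space) charted_space \<Rightarrow> 'e \<Rightarrow> 'g \<Rightarrow> 'e" where
  "left_invariant_field G X u a = tangent_map X X (\<lambda>b. a \<otimes>\<^bsub>G\<^esub> b) \<one>\<^bsub>G\<^esub> u"

definition lie_bracket ::
    "('g, 'z) monoid_scheme \<Rightarrow> ('g, 'e::euclidean_space) charted_space \<Rightarrow> 'e \<Rightarrow> 'e \<Rightarrow> 'e" where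
  "lie_bracket G X u v =
     vf_bracket X (left_invariant_field G X u) (left_invariant_field G X v) \<one>\<^bsub>G\<^esub>"

definition derived_algebra ::
    "('g, 'z) monoid_scheme \<Rightarrow> ('g, 'e::euclidean_space) charted_space \<Rightarrow> 'e set" where
  "derived_algebra G X = span {lie_bracket G X u v |u v. True}"

definition Ad ::
    "('g, 'z) monoid_scheme \<Rightarrow> ('g, 'e::euclidean_space) charted_space \<Rightarrow> 'g \<Rightarrow> 'e \<Rightarrow> 'e" where
  "Ad G X a = tangent_map X X (\<lambda>b. a \<otimes>\<^bsub>G\<^esub> b \<otimes>\<^bsub>G\<^esub> inv\<^bsub>G\<^esub> a) \<one>\<^bsub>G\<^esub>"

definition closed_subgroup ::
    "('g, 'z) monoid_scheme \<Rightarrow> ('g, 'e::euclidean_space) charted_space \<Rightarrow> 'g set \<Rightarrow> bool" where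
  "closed_subgroup G X H \<longleftrightarrow> subgroup H G \<and> closedin (mtop X) H"

text \<open>The Lie algebra of a closed subgroup \<open>H\<close> as the tangent space of \<open>H\<close> at the identity: the
  velocities at \<open>0\<close> of smooth curves in \<open>G\<close> that lie in \<open>H\<close>. The curve is required to stay inside
  the chart domain, because the coordinate map is arbitrary outside it.\<close>

definition subgroup_algebra ::
    "('g, 'z) monoid_scheme \<Rightarrow> ('g, 'e::euclidean_space) charted_space \<Rightarrow> 'g set \<Rightarrow> 'e set" where
  "subgroup_algebra G X H =
     {v. \<exists>(\<gamma> :: real \<Rightarrow> 'g) \<epsilon>. \<epsilon> > 0 \<and> \<gamma> 0 = \<one>\<^bsub>G\<^esub> \<and>
        (\<forall>t\<in>{-\<epsilon><..<\<epsilon>}. \<gamma> t \<in> H \<inter> fst (chart_at X \<one>\<^bsub>G\<^esub>)) \<and>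
        smooth_on {-\<epsilon><..<\<epsilon>} (snd (chart_at X \<one>\<^bsub>G\<^esub>) \<circ> \<gamma>) \<and>
        ((snd (chart_at X \<one>\<^bsub>G\<^esub>) \<circ> \<gamma>) has_vector_derivative v) (at 0)}"

definition direct_decomposition :: "'v::real_vector set \<Rightarrow> 'v set \<Rightarrow> 'v set \<Rightarrow> bool" where
  "direct_decomposition S A B \<longleftrightarrow>
     subspace A \<and> subspace B \<and> A \<inter> B = {0} \<and> S = {a + b |a b. a \<in> A \<and> b \<in> B}"

text \<open>The \<open>B\<close>-component with respect to a direct sum of \<open>A\<close> and \<open>B\<close>.\<close>

definition component :: "'v::real_vector set \<Rightarrow> 'v set \<Rightarrow> 'v \<Rightarrow> 'v" where
  "component A B v = (THE b. b \<in> B \<and> v - b \<in> A)"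

definition reductive_decomposition ::
    "('g, 'z) monoid_scheme \<Rightarrow> ('g, 'e::euclidean_space) charted_space \<Rightarrow> 'g set \<Rightarrow> 'e set \<Rightarrow> bool" where
  "reductive_decomposition G X H \<mm> \<longleftrightarrow>
     direct_decomposition UNIV (subgroup_algebra G X H) \<mm> \<and>
     (\<forall>a\<in>H. Ad G X a ` subgroup_algebra G X H \<subseteq> subgroup_algebra G X H \<and> Ad G X a ` \<mm> \<subseteq> \<mm>)"

text \<open>The manifold \<open>G/H\<close>: the set of left cosets with the unique smooth structure for which the
  projection from \<open>G\<close> is a smooth submersion.\<close>

definition homogeneous_manifold ::
    "('g, 'z) monoid_scheme \<Rightarrow> ('g, 'e::euclidean_space) charted_space \<Rightarrow> 'g set \<Rightarrow>
     ('g set, 'f::euclidean_space) charted_space \<Rightarrow> bool" where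
  "homogeneous_manifold G X H M \<longleftrightarrow>
     smooth_manifold M \<and> topspace (mtop M) = lcosets\<^bsub>G\<^esub> H \<and>
     smooth_submersion X M (\<lambda>a. a <#\<^bsub>G\<^esub> H)"

text \<open>The differential of the projection at the identity; restricted to \<open>\<mm>\<close> it is the
  identification of \<open>\<mm>\<close> with the tangent space of \<open>G/H\<close> at the base point \<open>o = eH = H\<close>.\<close>

definition isotropy_map ::
    "('g, 'z) monoid_scheme \<Rightarrow> ('g, 'e::euclidean_space) charted_space \<Rightarrow> 'g set \<Rightarrow>
     ('g set, 'f::euclidean_space) charted_space \<Rightarrow> 'e \<Rightarrow> 'f" where
  "isotropy_map G X H M = tangent_map X M (\<lambda>a. a <#\<^bsub>G\<^esub> H) \<one>\<^bsub>G\<^esub>"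

text \<open>The group acts on \<open>G/H\<close> by \<open>a \<cdot> bH = (ab)H\<close>, i.e. by \<open>p \<mapsto> a <# p\<close>.\<close>

abbreviation action_map ::
    "('g, 'z) monoid_scheme \<Rightarrow> ('g set, 'f::euclidean_space) charted_space \<Rightarrow>
     'g \<Rightarrow> 'g set \<Rightarrow> 'f \<Rightarrow> 'f" where
  "action_map G M a p \<equiv> tangent_map M M (\<lambda>q. a <#\<^bsub>G\<^esub> q) p"

definition invariant_function ::
    "('g, 'z) monoid_scheme \<Rightarrow> ('g set, 'f::euclidean_space) charted_space \<Rightarrow>
     ('g set \<Rightarrow> 'f \<Rightarrow> real) \<Rightarrow> bool" where
  "invariant_function G M F \<longleftrightarrow>
     (\<forall>a\<in>carrier G. \<forall>p\<in>topspace (mtop M). \<forall>y.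
        F (a <#\<^bsub>G\<^esub> p) (action_map G M a p y) = F p y)"

definition invariant_bilinear ::
    "('g, 'z) monoid_scheme \<Rightarrow> ('g set, 'f::euclidean_space) charted_space \<Rightarrow>
     ('g set \<Rightarrow> 'f \<Rightarrow> 'f \<Rightarrow> real) \<Rightarrow> bool" where
  "invariant_bilinear G M g \<longleftrightarrow>
     (\<forall>a\<in>carrier G. \<forall>p\<in>topspace (mtop M). \<forall>u v.
        g (a <#\<^bsub>G\<^esub> p) (action_map G M a p u) (action_map G M a p v) = g p u v)"

definition invariant_distribution ::
    "('g, 'z) monoid_scheme \<Rightarrow> ('g set, 'f::euclidean_space) charted_space \<Rightarrow>
     ('g set \<Rightarrow> 'f set) \<Rightarrow> bool" where
  "invariant_distribution G M V \<longleftrightarrow>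
     (\<forall>a\<in>carrier G. \<forall>p\<in>topspace (mtop M). action_map G M a p ` V p = V (a <#\<^bsub>G\<^esub> p))"


section \<open>Riemannian, Finsler and \<open>(\<alpha>\<^sub>1,\<alpha>\<^sub>2)\<close>-metrics\<close>

definition riemannian_metric ::
    "('p, 'e::euclidean_space) charted_space \<Rightarrow> ('p \<Rightarrow> 'e \<Rightarrow> 'e \<Rightarrow> real) \<Rightarrow> bool" where
  "riemannian_metric M g \<longleftrightarrow>
     (\<forall>p\<in>topspace (mtop M). bilinear (g p) \<and> (\<forall>u v. g p u v = g p v u) \<and>
        (\<forall>v. v \<noteq> 0 \<longrightarrow> g p v v > 0)) \<and>
     (\<forall>c\<in>atlas M. \<forall>u v. smooth_on (snd c ` fst c)
        (\<lambda>x. g (chart_inv c x)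
               (from_coord M c (chart_inv c x) u) (from_coord M c (chart_inv c x) v)))"

definition fundamental_tensor :: "('v::real_vector \<Rightarrow> real) \<Rightarrow> 'v \<Rightarrow> 'v \<Rightarrow> 'v \<Rightarrow> real" where
  "fundamental_tensor F y u v =
     1/2 * deriv (\<lambda>s. deriv (\<lambda>t. (F (y + s *\<^sub>R u + t *\<^sub>R v))\<^sup>2) 0) 0"

definition cartan_tensor :: "('v::real_vector \<Rightarrow> real) \<Rightarrow> 'v \<Rightarrow> 'v \<Rightarrow> 'v \<Rightarrow> 'v \<Rightarrow> real" where
  "cartan_tensor F y u v w =
     1/4 * deriv (\<lambda>r. deriv (\<lambda>s. deriv (\<lambda>t.
       (F (y + r *\<^sub>R u + s *\<^sub>R v + t *\<^sub>R w))\<^sup>2) 0) 0) 0"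

definition finsler_metric ::
    "('p, 'e::euclidean_space) charted_space \<Rightarrow> ('p \<Rightarrow> 'e \<Rightarrow> real) \<Rightarrow> bool" where
  "finsler_metric M F \<longleftrightarrow>
     (\<forall>p\<in>topspace (mtop M).
        F p 0 = 0 \<and> (\<forall>y. y \<noteq> 0 \<longrightarrow> F p y > 0) \<and>
        (\<forall>y k. k > 0 \<longrightarrow> F p (k *\<^sub>R y) = k * F p y) \<and>
        (\<forall>y v. y \<noteq> 0 \<longrightarrow> v \<noteq> 0 \<longrightarrow> fundamental_tensor (F p) y v v > 0)) \<and>
     (\<forall>c\<in>atlas M. smooth_on (snd c ` fst c \<times> (UNIV - {0}))
        (\<lambda>(x, y). F (chart_inv c x) (from_coord M c (chart_inv c x) y)))"

text \<open>The profile \<open>f\<close> is smooth and positive on the closed quadrant without the origin, smoothness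
  up to the boundary meaning smoothness on an open neighbourhood.\<close>

definition alpha12_metric ::
    "('p, 'e::euclidean_space) charted_space \<Rightarrow> ('p \<Rightarrow> 'e \<Rightarrow> real) \<Rightarrow> ('p \<Rightarrow> 'e \<Rightarrow> 'e \<Rightarrow> real) \<Rightarrow>
     ('p \<Rightarrow> 'e set) \<Rightarrow> ('p \<Rightarrow> 'e set) \<Rightarrow> bool" where
  "alpha12_metric M F g V1 V2 \<longleftrightarrow>
     finsler_metric M F \<and> riemannian_metric M g \<and>
     smooth_subbundle M V1 \<and> smooth_subbundle M V2 \<and>
     (\<forall>p\<in>topspace (mtop M). direct_decomposition UNIV (V1 p) (V2 p) \<and>
        (\<forall>u\<in>V1 p. \<forall>v\<in>V2 p. g p u v = 0)) \<and>
     (\<exists>(f :: real \<times> real \<Rightarrow> real) W.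
        open W \<and> {0..} \<times> {0..} - {(0, 0)} \<subseteq> W \<and> smooth_on W f \<and>
        (\<forall>a\<ge>0. \<forall>b\<ge>0. (a, b) \<noteq> (0, 0) \<longrightarrow> f (a, b) > 0) \<and>
        (\<forall>p\<in>topspace (mtop M). \<forall>y1\<in>V1 p. \<forall>y2\<in>V2 p. y1 + y2 \<noteq> 0 \<longrightarrow>
           F p (y1 + y2) = f (sqrt (g p y1 y1), sqrt (g p y2 y2))))"


section \<open>Natural reductivity\<close>

definition naturally_reductive_riemannian ::
    "('g, 'z) monoid_scheme \<Rightarrow> ('g, 'e::euclidean_space) charted_space \<Rightarrow> 'g set \<Rightarrow>
     ('g set, 'f::euclidean_space) charted_space \<Rightarrow> ('g set \<Rightarrow> 'f \<Rightarrow> 'f \<Rightarrow> real) \<Rightarrow> 'e set \<Rightarrow> bool" where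
  "naturally_reductive_riemannian G X H M g \<mm> \<longleftrightarrow>
     reductive_decomposition G X H \<mm> \<and>
     (let ip = (\<lambda>u v. g H (isotropy_map G X H M u) (isotropy_map G X H M v));
          br = (\<lambda>u v. component (subgroup_algebra G X H) \<mm> (lie_bracket G X u v))
      in \<forall>z\<in>\<mm>. \<forall>u\<in>\<mm>. \<forall>v\<in>\<mm>. ip (br z u) v + ip u (br z v) = 0)"

definition naturally_reductive_finsler ::
    "('g, 'z) monoid_scheme \<Rightarrow> ('g, 'e::euclidean_space) charted_space \<Rightarrow> 'g set \<Rightarrow>
     ('g set, 'f::euclidean_space) charted_space \<Rightarrow> ('g set \<Rightarrow> 'f \<Rightarrow> real) \<Rightarrow> bool" where
  "naturally_reductive_finsler G X H M F \<longleftrightarrow>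
     invariant_function G M F \<and>
     (\<exists>\<mm>. reductive_decomposition G X H \<mm> \<and>
        (let Fo = (\<lambda>y. F H (isotropy_map G X H M y));
             br = (\<lambda>u v. component (subgroup_algebra G X H) \<mm> (lie_bracket G X u v))
         in \<forall>y\<in>\<mm>. \<forall>u\<in>\<mm>. \<forall>x\<in>\<mm>. \<forall>z\<in>\<mm>. y \<noteq> 0 \<longrightarrow>
              fundamental_tensor Fo y u (br z x) + fundamental_tensor Fo y (br z u) x
              + 2 * cartan_tensor Fo y (br z y) u x = 0))"

end

theory Submission
  imports Defs
begin

text \<open>For \<open>z \<in> \<mm>\<close> let \<open>B = [z, \<cdot>]\<^sub>\<mm>\<close>. Natural reductivity of \<open>g\<close> says that \<open>B\<close> is
  skew-adjoint on \<open>\<mm>\<close>, and the condition on \<open>[\<gg>, \<gg>]\<close> says that \<open>B\<close> takes values in \<open>\<mm>\<^sub>1\<close>. Write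
  \<open>w = w\<^sub>1 + w\<^sub>2\<close> in \<open>\<mm>\<^sub>1 + \<mm>\<^sub>2\<close>. Then \<open>B w\<close> is orthogonal to \<open>w\<close> and to \<open>w\<^sub>2\<close>, hence to \<open>w\<^sub>1\<close>, so moving from \<open>w\<close>
  to \<open>w + t B w\<close> leaves \<open>w\<^sub>2\<close> unchanged and makes the length of the \<open>\<mm>\<^sub>1\<close>-component an even
  function of \<open>t\<close>. Therefore \<open>t \<mapsto> F\<^sup>2 (w + t B w)\<close> is even; differentiating this in two directions of
  \<open>w\<close> and then in \<open>t\<close> at \<open>0\<close> gives the identity between the fundamental and the Cartan tensor.
  The identification of \<open>\<mm>\<close> with \<open>T\<^sub>o(G/H)\<close> is injective because, by the inverse function theorem, every
  vector killed by the differential of \<open>G \<rightarrow> G/H\<close> is the velocity of a smooth curve in \<open>H\<close>.\<close>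

section \<open>Calculus of \<open>C\<^sup>k\<close> maps\<close>

lemma Ck_on_cong:
  assumes "open S" "\<And>x. x \<in> S \<Longrightarrow> f x = g x" "Ck_on k S f"
  shows "Ck_on k S g"
  using assms(2,3)
proof (induction k arbitrary: f g)
  case 0
  then show ?case by (simp add: continuous_on_eq)
next
  case (Suc k)
  have der: "(g has_derivative frechet_derivative f (at x)) (at x)" if "x \<in> S" for x
    using Suc.prems that
    by (auto intro: has_derivative_transform_within_open[OF _ assms(1)] simp: frechet_derivative_works)
  have "Ck_on k S (\<lambda>x. frechet_derivative g (at x) v)" for v
  proof (rule Suc.IH)
    show "frechet_derivative f (at x) v = frechet_derivative g (at x) v" if "x \<in> S" for x
      using frechet_derivative_at[OF der[OF that]] by simp
  qed (use Suc.prems in simp)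
  with der show ?case by (auto simp: differentiable_def)
qed

text \<open>\<open>Ck_on\<close> is tied to the chosen \<open>frechet_derivative\<close>.
  Derivatives are unique, so any explicit family \<open>f'\<close> agrees with it on
  \<open>S\<close>, and product or chain rule formulas can enter the inductions.\<close>

lemma Ck_on_SucI:
  assumes "open S" "\<And>x. x \<in> S \<Longrightarrow> (f has_derivative f' x) (at x)"
    and "\<And>v. Ck_on k S (\<lambda>x. f' x v)"
  shows "Ck_on (Suc k) S f"
proof -
  have eq: "f' x v = frechet_derivative f (at x) v" if "x \<in> S" for x v
    using assms(2)[OF that] by (metis frechet_derivative_at)
  have "Ck_on k S (\<lambda>x. frechet_derivative f (at x) v)" for v
    by (rule Ck_on_cong[OF assms(1) eq assms(3)])
  with assms(2) show ?thesis by (auto simp: differentiable_def)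
qed

lemma Ck_on_SucD:
  assumes "Ck_on (Suc k) S f" "x \<in> S"
  shows "(f has_derivative frechet_derivative f (at x)) (at x)"
  using assms by (simp add: frechet_derivative_works)

lemma Ck_on_pred: "Ck_on (Suc k) S f \<Longrightarrow> Ck_on k S f"
proof (induction k arbitrary: f)
  case 0
  then show ?case
    by (simp add: continuous_at_imp_continuous_on differentiable_imp_continuous_within)
next
  case (Suc k)
  from Suc.prems[unfolded Ck_on.simps(2)[of "Suc k"]] Suc.IH show ?case
    by (subst Ck_on.simps(2)) blast
qed

lemma Ck_on_const: "Ck_on k S (\<lambda>x. c)"
  by (induction k arbitrary: c) auto

lemma Ck_on_ident: "Ck_on k S (\<lambda>x. x)"
  by (cases k) (auto intro: Ck_on_const)

lemma Ck_on_bounded_linear: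
  assumes "open S" "bounded_linear L" "Ck_on k S f"
  shows "Ck_on k S (\<lambda>x. L (f x))"
  using assms(3)
proof (induction k arbitrary: f)
  case 0
  then show ?case by (simp add: bounded_linear.continuous_on[OF assms(2)])
next
  case (Suc k)
  show ?case
    by (rule Ck_on_SucI[OF assms(1) bounded_linear.has_derivative[OF assms(2) Ck_on_SucD[OF Suc.prems]]])
      (use Suc in auto)
qed

lemma Ck_on_add:
  assumes "open S" "Ck_on k S f" "Ck_on k S g"
  shows "Ck_on k S (\<lambda>x. f x + g x)"
  using assms(2,3)
proof (induction k arbitrary: f g)
  case 0
  then show ?case by (simp add: continuous_on_add)
next
  case (Suc k)
  show ?case
    by (rule Ck_on_SucI[OF assms(1) has_derivative_add[OF Ck_on_SucD[OF Suc.prems(1)] Ck_on_SucD[OF Suc.prems(2)]]])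
      (use Suc in auto)
qed

lemma Ck_on_sum:
  assumes "open S" "\<And>i. i \<in> I \<Longrightarrow> Ck_on k S (f i)"
  shows "Ck_on k S (\<lambda>x. \<Sum>i\<in>I. f i x)"
  using assms(2)
  by (induction I rule: infinite_finite_induct) (auto intro: Ck_on_const Ck_on_add[OF assms(1)])

lemma Ck_on_bilinear:
  assumes "open S" "bounded_bilinear b" "Ck_on k S f" "Ck_on k S g"
  shows "Ck_on k S (\<lambda>x. b (f x) (g x))"
  using assms(3,4)
proof (induction k arbitrary: f g)
  case 0
  then show ?case by (simp add: bounded_bilinear.continuous_on[OF assms(2)])
next
  case (Suc k)
  have "Ck_on k S (\<lambda>x. b (f x) (frechet_derivative g (at x) v) + b (frechet_derivative f (at x) v) (g x))" for v
    by (rule Ck_on_add[OF assms(1) Suc.IH Suc.IH])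
      (use Suc.prems Ck_on_pred[OF Suc.prems(1)] Ck_on_pred[OF Suc.prems(2)] in auto)
  from Ck_on_SucI[OF assms(1) bounded_bilinear.FDERIV[OF assms(2) Ck_on_SucD[OF Suc.prems(1)] Ck_on_SucD[OF Suc.prems(2)]] this]
  show ?case .
qed

lemma linear_euclidean_expand:
  fixes L :: "'a::euclidean_space \<Rightarrow> 'b::real_vector"
  assumes "linear L"
  shows "L w = (\<Sum>b\<in>Basis. (w \<bullet> b) *\<^sub>R L b)"
proof -
  have "L w = L (\<Sum>b\<in>Basis. (w \<bullet> b) *\<^sub>R b)" by (simp add: euclidean_representation)
  also have "\<dots> = (\<Sum>b\<in>Basis. (w \<bullet> b) *\<^sub>R L b)" using assms by (simp add: linear_sum linear_scale)
  finally show ?thesis .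
qed

text \<open>The chain rule differentiates \<open>f\<close> in a direction that varies with the
  point, while \<open>Ck_on\<close> speaks of fixed directions only. Expanding the direction in
  \<open>Basis\<close> gives a finite sum of scalar coefficients times fixed directional
  derivatives, to which the induction hypothesis applies.\<close>

lemma Ck_on_compose:
  fixes h :: "'c::real_normed_vector \<Rightarrow> 'a::euclidean_space"
    and f :: "'a \<Rightarrow> 'b::real_normed_vector"
  assumes "open S" "Ck_on k U f" "Ck_on k S h" "h ` S \<subseteq> U"
  shows "Ck_on k S (\<lambda>x. f (h x))"
  using assms(2,3)
proof (induction k arbitrary: f)
  case 0
  then show ?case using assms(4) by (simp add: continuous_on_compose2)
next
  case (Suc k)
  have df: "(f has_derivative frechet_derivative f (at (h x))) (at (h x))" if "x \<in> S" for x
    by (rule Ck_on_SucD[OF Suc.prems(1)]) (use that assms(4) in auto)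
  have exp: "(\<Sum>b\<in>Basis. (frechet_derivative h (at x) v \<bullet> b) *\<^sub>R frechet_derivative f (at (h x)) b)
      = frechet_derivative f (at (h x)) (frechet_derivative h (at x) v)" if "x \<in> S" for x v
    by (rule linear_euclidean_expand[symmetric]) (use df[OF that] has_derivative_linear in blast)
  have "Ck_on k S (\<lambda>x. frechet_derivative f (at (h x)) (frechet_derivative h (at x) v))" for v
  proof (rule Ck_on_cong[OF assms(1) exp], assumption)
    show "Ck_on k S (\<lambda>x. \<Sum>b\<in>Basis. (frechet_derivative h (at x) v \<bullet> b) *\<^sub>R frechet_derivative f (at (h x)) b)"
      using Suc.prems Suc.IH[OF _ Ck_on_pred[OF Suc.prems(2)]]
      by (intro Ck_on_sum assms(1) Ck_on_bilinear[OF assms(1) bounded_bilinear_scaleR]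
          Ck_on_bounded_linear[OF assms(1) bounded_linear_inner_left]) auto
  qed
  then show ?case
    by (intro Ck_on_SucI[OF assms(1) has_derivative_compose[OF Ck_on_SucD[OF Suc.prems(2)] df]])
qed

lemma Ck_on_real_SucI:
  fixes f :: "real \<Rightarrow> 'b::real_normed_vector"
  assumes "open S" "\<And>t. t \<in> S \<Longrightarrow> (f has_vector_derivative f' t) (at t)" "Ck_on k S f'"
  shows "Ck_on (Suc k) S f"
  by (rule Ck_on_SucI[OF assms(1) assms(2)[unfolded has_vector_derivative_def]
        Ck_on_bounded_linear[OF assms(1) bounded_linear_scaleR_right assms(3)]])

text \<open>\<open>A x\<close> is a sum of rank-one operators that depend linearly on the values of
  \<open>A x\<close> on \<open>Basis\<close>; regularity in operator norm can therefore be checked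
  column by column.\<close>

lemma Ck_on_blinfun:
  fixes A :: "'c::real_normed_vector \<Rightarrow> 'a::euclidean_space \<Rightarrow>\<^sub>L 'b::euclidean_space"
  assumes "open S" "\<And>b. b \<in> Basis \<Longrightarrow> Ck_on k S (\<lambda>x. A x b)"
  shows "Ck_on k S A"
proof -
  have "Ck_on k S (\<lambda>x. \<Sum>b\<in>Basis. blinfun_scaleR_left (A x b) o\<^sub>L blinfun_inner_left b)"
    by (intro Ck_on_sum assms Ck_on_bounded_linear[OF assms(1) bounded_bilinear.bounded_linear_left[OF bounded_bilinear_blinfun_compose]]
        Ck_on_bounded_linear[OF assms(1) bounded_linear_blinfun_scaleR_left])
  moreover have "(\<Sum>b\<in>Basis. blinfun_scaleR_left (A x b) o\<^sub>L blinfun_inner_left b) = A x" for x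
  proof (rule blinfun_eqI)
    show "(\<Sum>b\<in>Basis. blinfun_scaleR_left (A x b) o\<^sub>L blinfun_inner_left b) w = A x w" for w
      using linear_euclidean_expand[OF bounded_linear.linear[OF blinfun.bounded_linear_right], of "A x" w]
      by (simp add: blinfun.sum_left inner_commute)
  qed
  ultimately show ?thesis by simp
qed

section \<open>Inverses of curves of bounded operators\<close>

lemma has_vector_derivative_iff_DQ:
  "(f has_vector_derivative D) (at t) \<longleftrightarrow> ((\<lambda>s. (f s - f t) /\<^sub>R (s - t)) \<longlongrightarrow> D) (at t)"
proof -
  have "norm ((f s - f t - (s - t) *\<^sub>R D) /\<^sub>R norm (s - t)) = norm ((f s - f t) /\<^sub>R (s - t) - D)" if "s \<noteq> t" for s
  proof -
    have "(f s - f t) /\<^sub>R (s - t) - D = (f s - f t - (s - t) *\<^sub>R D) /\<^sub>R (s - t)"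
      using that by (simp add: scaleR_diff_right)
    then show ?thesis by simp
  qed
  then have "((\<lambda>s. norm ((f s - f t - (s - t) *\<^sub>R D) /\<^sub>R norm (s - t))) \<longlongrightarrow> 0) (at t)
      \<longleftrightarrow> ((\<lambda>s. norm ((f s - f t) /\<^sub>R (s - t) - D)) \<longlongrightarrow> 0) (at t)"
    by (intro tendsto_cong) (simp add: eventually_at_filter)
  then show ?thesis
    unfolding has_vector_derivative_def has_derivative_at_within tendsto_norm_zero_iff
    by (simp add: bounded_linear_scaleR_left LIM_zero_iff)
qed

text \<open>The resolvent identity: write \<open>B'\<close> as \<open>B' A B\<close> and
  \<open>B\<close> as \<open>B' A' B\<close>. It yields both continuity and differentiability of
  inversion.\<close>

lemma blinfun_inverse_diff:
  fixes A B A' B' :: "'a::real_normed_vector \<Rightarrow>\<^sub>L 'a"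
  assumes "A o\<^sub>L B = id_blinfun" "B' o\<^sub>L A' = id_blinfun"
  shows "B' - B = - (B' o\<^sub>L (A' - A) o\<^sub>L B)"
proof (rule blinfun_eqI)
  fix w
  have "(A o\<^sub>L B) w = w" "(B' o\<^sub>L A') (B w) = B w"
    by (simp_all only: assms blinfun_apply_id_blinfun)
  then show "(B' - B) w = (- (B' o\<^sub>L (A' - A) o\<^sub>L B)) w"
    by (simp add: blinfun.diff_left blinfun.diff_right blinfun.minus_left)
qed

context
  fixes A B :: "real \<Rightarrow> 'a::real_normed_vector \<Rightarrow>\<^sub>L 'a" and S K
  assumes S: "open S"
    and AB: "\<And>s. s \<in> S \<Longrightarrow> A s o\<^sub>L B s = id_blinfun" "\<And>s. s \<in> S \<Longrightarrow> B s o\<^sub>L A s = id_blinfun"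
    and K: "\<And>s. s \<in> S \<Longrightarrow> norm (B s) \<le> K"
begin

text \<open>The uniform bound \<open>K\<close> turns the resolvent identity into an estimate of
  \<open>B s - B t\<close> by \<open>K\<close> times the norms of \<open>A s - A t\<close> and
  \<open>B t\<close>.\<close>

lemma blinfun_inverse_tendsto:
  assumes t: "t \<in> S" and A: "(A \<longlongrightarrow> A t) (at t)"
  shows "(B \<longlongrightarrow> B t) (at t)"
proof -
  have ev: "eventually (\<lambda>s. s \<in> S) (at t)"
    using S t by (simp add: eventually_at_in_open')
  have "((\<lambda>s. - (B s o\<^sub>L (A s - A t) o\<^sub>L B t)) \<longlongrightarrow> 0) (at t)"
  proof (rule Lim_null_comparison)
    show "\<forall>\<^sub>F s in at t. norm (- (B s o\<^sub>L (A s - A t) o\<^sub>L B t)) \<le> K * norm (A s - A t) * norm (B t)"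
      using ev
    proof eventually_elim
      case (elim s)
      have "norm (B s o\<^sub>L (A s - A t) o\<^sub>L B t) \<le> norm (B s) * norm (A s - A t) * norm (B t)"
        by (rule order_trans[OF norm_blinfun_compose mult_right_mono[OF norm_blinfun_compose norm_ge_zero]])
      also have "\<dots> \<le> K * norm (A s - A t) * norm (B t)"
        using K[OF elim] by (intro mult_right_mono) auto
      finally show ?case by simp
    qed
    show "((\<lambda>s. K * norm (A s - A t) * norm (B t)) \<longlongrightarrow> 0) (at t)"
      by (rule tendsto_eq_intros A refl | simp)+
  qed
  then have "((\<lambda>s. B s - B t) \<longlongrightarrow> 0) (at t)"
    by (rule Lim_transform_eventually)
      (use ev in eventually_elim, simp add: blinfun_inverse_diff[OF AB(1)[OF t] AB(2)])
  then show ?thesis by (simp add: LIM_zero_iff)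
qed

text \<open>Divide the resolvent identity by \<open>s - t\<close> and pass to the limit; the left
  factor \<open>B s\<close> converges by the continuity just shown.\<close>

lemma blinfun_inverse_has_vector_derivative:
  assumes t: "t \<in> S" and A': "(A has_vector_derivative A') (at t)"
  shows "(B has_vector_derivative - (B t o\<^sub>L A' o\<^sub>L B t)) (at t)"
proof -
  interpret c: bounded_bilinear "(o\<^sub>L) :: ('a \<Rightarrow>\<^sub>L 'a) \<Rightarrow> ('a \<Rightarrow>\<^sub>L 'a) \<Rightarrow> _"
    by (rule bounded_bilinear_blinfun_compose)
  have ev: "eventually (\<lambda>s. s \<in> S) (at t)"
    using S t by (simp add: eventually_at_in_open')
  have B: "(B \<longlongrightarrow> B t) (at t)"
    using has_vector_derivative_continuous[OF A']
    by (intro blinfun_inverse_tendsto[OF t]) (simp add: continuous_within)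
  have "((\<lambda>s. (A s - A t) /\<^sub>R (s - t)) \<longlongrightarrow> A') (at t)"
    using A' by (simp add: has_vector_derivative_iff_DQ)
  then have "((\<lambda>s. - (B s o\<^sub>L ((A s - A t) /\<^sub>R (s - t)) o\<^sub>L B t)) \<longlongrightarrow> - (B t o\<^sub>L A' o\<^sub>L B t)) (at t)"
    by (intro tendsto_intros c.tendsto B)
  then have "((\<lambda>s. (B s - B t) /\<^sub>R (s - t)) \<longlongrightarrow> - (B t o\<^sub>L A' o\<^sub>L B t)) (at t)"
  proof (rule Lim_transform_eventually)
    show "\<forall>\<^sub>F s in at t. - (B s o\<^sub>L ((A s - A t) /\<^sub>R (s - t)) o\<^sub>L B t) = (B s - B t) /\<^sub>R (s - t)"
      using ev
      by eventually_elim
        (simp only: blinfun_inverse_diff[OF AB(1)[OF t] AB(2)] c.scaleR_left c.scaleR_right scaleR_minus_right)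
  qed
  then show ?thesis by (simp add: has_vector_derivative_iff_DQ)
qed

text \<open>Bootstrapping: the derivative of \<open>B\<close> is \<open>- B A' B\<close>, which has
  the regularity already known for \<open>B\<close> and for the derivative of \<open>A\<close>, so
  \<open>B\<close> gains one order.\<close>

lemma Ck_on_blinfun_inverse: "Ck_on k S A \<Longrightarrow> Ck_on k S B"
proof (induction k)
  case 0
  then show ?case
    using blinfun_inverse_tendsto S by (simp add: continuous_on_eq_continuous_at continuous_at)
next
  case (Suc k)
  note dB = blinfun_inverse_has_vector_derivative[OF _ vector_derivative_works[THEN iffD1]]
  have cA: "Ck_on k S (\<lambda>t. vector_derivative A (at t))"
  proof (rule Ck_on_cong[OF S])
    show "frechet_derivative A (at t) 1 = vector_derivative A (at t)" if "t \<in> S" for t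
      using Suc.prems that by (simp add: frechet_derivative_eq_vector_derivative)
    show "Ck_on k S (\<lambda>t. frechet_derivative A (at t) 1)"
      using Suc.prems by simp
  qed
  have cB: "Ck_on k S B"
    by (rule Suc.IH[OF Ck_on_pred[OF Suc.prems]])
  show ?case
  proof (rule Ck_on_real_SucI[OF S])
    show "(B has_vector_derivative - (B t o\<^sub>L vector_derivative A (at t) o\<^sub>L B t)) (at t)" if "t \<in> S" for t
      using Suc.prems that by (intro dB) simp_all
    show "Ck_on k S (\<lambda>t. - (B t o\<^sub>L vector_derivative A (at t) o\<^sub>L B t))"
      by (intro Ck_on_bounded_linear[OF S bounded_linear_minus[OF bounded_linear_ident]]
          Ck_on_bilinear[OF S bounded_bilinear_blinfun_compose] cA cB)
  qed
qed

end

section \<open>Level sets of submersions\<close>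

text \<open>A right inverse \<open>R\<close> of the differential at \<open>x0\<close> completes
  \<phi> to a local diffeomorphism \<Psi>. Its inverse carries a short line in the direction of the
  kernel vector \<open>v\<close> into the level set.\<close>

lemma submersion_level_curve:
  fixes \<phi> :: "'e::euclidean_space \<Rightarrow> 'f::euclidean_space"
  assumes W: "open W" "x0 \<in> W" and smooth: "smooth_on W \<phi>"
    and surj: "surj (frechet_derivative \<phi> (at x0))"
    and ker: "frechet_derivative \<phi> (at x0) v = 0"
  obtains x :: "real \<Rightarrow> 'e" and \<epsilon> where "\<epsilon> > 0" "x 0 = x0"
    "\<And>t. t \<in> {-\<epsilon><..<\<epsilon>} \<Longrightarrow> x t \<in> W \<and> \<phi> (x t) = \<phi> x0"
    "smooth_on {-\<epsilon><..<\<epsilon>} x" "(x has_vector_derivative v) (at 0)"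
proof -
  define D where "D = (\<lambda>x. frechet_derivative \<phi> (at x))"
  have Ck\<phi>: "Ck_on k W \<phi>" for k using smooth by (simp add: smooth_on_def)
  have D: "(\<phi> has_derivative D x) (at x)" if "x \<in> W" for x
    unfolding D_def by (rule Ck_on_SucD[OF Ck\<phi> that])
  have lin: "linear (D x)" if "x \<in> W" for x
    using D[OF that] has_derivative_linear by blast
  obtain R where R: "linear R" "D x0 \<circ> R = id"
    using linear_surjective_right_inverse[OF lin[OF W(2)]] surj unfolding D_def by auto
  have DR: "D x0 (R w) = w" for w using R(2) by (metis comp_apply id_apply)
  have bR: "bounded_linear R" and bD0: "bounded_linear (D x0)"
    using R(1) lin[OF W(2)] by (simp_all add: linear_conv_bounded_linear)
  \<comment> \<open>\<open>\<Psi>\<close> straightens \<open>\<phi>\<close>: \<open>D x0 (\<Psi> x) = \<phi> x - \<phi> x0\<close>, and its derivative at \<open>x0\<close> is the identity.\<close>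
  define \<Psi> where "\<Psi> = (\<lambda>x. R (\<phi> x - \<phi> x0) + (x - x0) - R (D x0 (x - x0)))"
  define E where "E = (\<lambda>x w. R (D x w) + w - R (D x0 w))"
  \<comment> \<open>The inverse function theorem asks for a derivative that is continuous in
    operator norm, hence the passage to bounded operators.\<close>
  define \<Psi>' where "\<Psi>' = (\<lambda>x. Blinfun (E x))"
  have bE: "bounded_linear (E x)" if "x \<in> W" for x
    using D[OF that] has_derivative_bounded_linear unfolding E_def
    by (intro bounded_linear_add bounded_linear_sub bounded_linear_ident
        bounded_linear_compose[OF bR] bD0) blast+
  have \<Psi>'_apply: "\<Psi>' x w = E x w" if "x \<in> W" for x w
    unfolding \<Psi>'_def using bounded_linear_Blinfun_apply[OF bE[OF that]] by simp
  have der\<Psi>: "(\<Psi> has_derivative blinfun_apply (\<Psi>' x)) (at x)" if "x \<in> W" for x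
  proof -
    have "(\<Psi> has_derivative E x) (at x)"
      unfolding \<Psi>_def E_def
      by (rule derivative_eq_intros D[OF that] bounded_linear.has_derivative[OF bR]
          bounded_linear.has_derivative[OF bD0] refl | simp)+
    also have "E x = blinfun_apply (\<Psi>' x)" using \<Psi>'_apply[OF that] by auto
    finally show ?thesis .
  qed
  have Ck\<Psi>': "Ck_on k W \<Psi>'" for k
  proof (rule Ck_on_blinfun[OF W(1)])
    fix b :: 'e
    have "Ck_on k W (\<lambda>x. R (D x b) + (b - R (D x0 b)))"
      using Ck\<phi>[of "Suc k"]
      by (intro Ck_on_add W(1) Ck_on_const Ck_on_bounded_linear[OF W(1) bR]) (simp add: D_def)
    then show "Ck_on k W (\<lambda>x. \<Psi>' x b)"
      by (rule Ck_on_cong[OF W(1), rotated]) (simp add: \<Psi>'_apply E_def)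
  qed
  have \<Psi>'0: "\<Psi>' x0 = id_blinfun"
    by (rule blinfun_eqI) (simp add: \<Psi>'_apply[OF W(2)] E_def)
  have cont\<Psi>': "continuous_on W \<Psi>'" using Ck\<Psi>'[of 0] by simp
  obtain U' V \<Theta> \<Theta>' where U': "open U'" "U' \<subseteq> W" "x0 \<in> U'" and V: "open V" "\<Psi> x0 \<in> V"
    and hom: "homeomorphism U' V \<Psi> \<Theta>"
    and \<Theta>: "\<And>y. y \<in> V \<Longrightarrow> (\<Theta> has_derivative (\<Theta>' y)) (at y)"
    and \<Theta>': "\<And>y. y \<in> V \<Longrightarrow> \<Theta>' y = inv_into UNIV (blinfun_apply (\<Psi>' (\<Theta> y)))"
    and bij: "\<And>y. y \<in> V \<Longrightarrow> bij (blinfun_apply (\<Psi>' (\<Theta> y)))"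
    by (rule inverse_function_theorem[OF W(1) der\<Psi> cont\<Psi>' W(2), of id_blinfun]) (auto simp: \<Psi>'0 intro!: blinfun_eqI)
  have \<Psi>x0: "\<Psi> x0 = 0"
    using R(1) lin[OF W(2)] by (simp add: \<Psi>_def linear_0)
  have \<Theta>U: "\<Theta> y \<in> U'" "\<Psi> (\<Theta> y) = y" if "y \<in> V" for y
    using hom that by (auto simp: homeomorphism_def)
  have \<Theta>0: "\<Theta> 0 = x0"
    using hom U'(3) \<Psi>x0 by (metis homeomorphism_apply1)
  \<comment> \<open>Staying within 1/2 of the identity bounds the inverse operators by 2, the
    uniform bound that differentiating them requires.\<close>
  define N where "N = {y \<in> V. norm (\<Psi>' (\<Theta> y) - id_blinfun) < 1/2}"
  have "continuous_on V (\<lambda>y. norm (\<Psi>' (\<Theta> y) - id_blinfun))"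
    using hom U'(2)
    by (intro continuous_intros continuous_on_compose2[OF cont\<Psi>']) (auto simp: homeomorphism_def)
  then have "open (V \<inter> (\<lambda>y. norm (\<Psi>' (\<Theta> y) - id_blinfun)) -` {..<1/2})"
    by (intro continuous_open_preimage V(1)) auto
  moreover have "V \<inter> (\<lambda>y. norm (\<Psi>' (\<Theta> y) - id_blinfun)) -` {..<1/2} = N"
    by (auto simp: N_def)
  ultimately have N: "open N" by simp
  have "0 \<in> N" using V(2) by (simp add: N_def \<Psi>x0 \<Theta>0 \<Psi>'0)
  have "open ((\<lambda>t::real. t *\<^sub>R v) -` N)"
    by (rule continuous_open_vimage[OF N]) (intro continuous_intros)
  moreover have "0 \<in> (\<lambda>t::real. t *\<^sub>R v) -` N" using \<open>0 \<in> N\<close> by simp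
  ultimately obtain \<epsilon> where \<epsilon>: "\<epsilon> > 0" "ball 0 \<epsilon> \<subseteq> (\<lambda>t::real. t *\<^sub>R v) -` N"
    using open_contains_ball by blast
  define I where "I = {-\<epsilon><..<\<epsilon>}"
  have I: "open I" by (simp add: I_def)
  have tN: "t *\<^sub>R v \<in> N" and tV: "t *\<^sub>R v \<in> V" if "t \<in> I" for t
  proof -
    have "t \<in> ball 0 \<epsilon>" using that by (auto simp: I_def)
    with \<epsilon>(2) show "t *\<^sub>R v \<in> N" by blast
    then show "t *\<^sub>R v \<in> V" by (simp add: N_def)
  qed
  \<comment> \<open>The velocity at 0 is \<open>v\<close> itself, since \<Psi> has derivative the
    identity at \<open>x0\<close>.\<close>
  define x where "x = (\<lambda>t::real. \<Theta> (t *\<^sub>R v))"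
  have xW: "x t \<in> W" if "t \<in> I" for t
    using \<Theta>U(1)[OF tV[OF that]] U'(2) by (auto simp: x_def)
  define A where "A = (\<lambda>t. \<Psi>' (x t))"
  define B where "B = (\<lambda>t. Blinfun (\<Theta>' (t *\<^sub>R v)))"
  have B_apply: "B t w = \<Theta>' (t *\<^sub>R v) w" if "t \<in> I" for t w
    unfolding B_def
    using bounded_linear_Blinfun_apply[OF has_derivative_bounded_linear[OF \<Theta>[OF tV[OF that]]]] by simp
  have AB: "A t o\<^sub>L B t = id_blinfun" "B t o\<^sub>L A t = id_blinfun" if "t \<in> I" for t
    using bij[OF tV[OF that]]
    by (auto intro!: blinfun_eqI simp: B_apply[OF that] \<Theta>'[OF tV[OF that]] A_def x_def
        bij_is_surj surj_f_inv_f bij_is_inj)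
  have K: "norm (B t) \<le> 2" if "t \<in> I" for t
  proof (rule norm_blinfun_bound)
    fix w
    have "(A t o\<^sub>L B t) w = w" by (simp only: AB(1)[OF that] blinfun_apply_id_blinfun)
    \<comment> \<open>The perturbation term is at most half of the norm of \<open>B t w\<close> and
      is absorbed on the left.\<close>
    then have "B t w = w - (A t - id_blinfun) (B t w)" by (simp add: blinfun.diff_left)
    then have "norm (B t w) \<le> norm w + norm ((A t - id_blinfun) (B t w))"
      using norm_triangle_ineq4 by metis
    also have "norm ((A t - id_blinfun) (B t w)) \<le> 1/2 * norm (B t w)"
      using tN[OF that]
      by (intro order_trans[OF norm_blinfun] mult_right_mono) (auto simp: N_def A_def x_def)
    finally show "norm (B t w) \<le> 2 * norm w" by simp
  qed simp
  have dx: "(x has_vector_derivative B t v) (at t)" if "t \<in> I" for t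
  proof -
    have "((\<lambda>t. t *\<^sub>R v) has_derivative (\<lambda>h. h *\<^sub>R v)) (at t)"
      by (rule bounded_linear_imp_has_derivative[OF bounded_linear_scaleR_left])
    from has_derivative_compose[OF this \<Theta>[OF tV[OF that]]]
    have "(x has_derivative (\<lambda>h. \<Theta>' (t *\<^sub>R v) (h *\<^sub>R v))) (at t)" by (simp add: x_def)
    then show ?thesis
      unfolding has_vector_derivative_def B_apply[OF that, symmetric] by (simp add: blinfun.scaleR_right)
  qed
  \<comment> \<open>The inverse function theorem provides only one derivative. The rest comes from
    the equation \<open>x' = B v\<close>, with \<open>B\<close> inverse to \<Psi>' along
    \<open>x\<close>: regularity of \<open>x\<close> passes to \<open>A\<close>, then to
    \<open>B\<close>, and returns to \<open>x\<close> one order higher.\<close>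
  have "Ck_on k I x" for k
  proof (induction k)
    case 0
    then show ?case
      using dx by (auto intro!: continuous_at_imp_continuous_on has_vector_derivative_continuous)
  next
    case (Suc k)
    have "Ck_on k I A"
      unfolding A_def by (rule Ck_on_compose[OF I Ck\<Psi>' Suc]) (use xW in auto)
    from Ck_on_blinfun_inverse[OF I AB K this] have "Ck_on k I B" .
    from Ck_on_real_SucI[OF I dx
        Ck_on_bounded_linear[OF I bounded_bilinear.bounded_linear_left[OF bounded_bilinear_blinfun_apply] this]]
    show ?case .
  qed
  then have smx: "smooth_on I x" by (simp add: smooth_on_def)
  have level: "\<phi> (x t) = \<phi> x0" if "t \<in> I" for t
  proof -
    have "D x0 (\<Psi> (x t)) = \<phi> (x t) - \<phi> x0"
      using lin[OF W(2)] by (simp add: \<Psi>_def linear_add linear_diff DR)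
    moreover have "D x0 (\<Psi> (x t)) = 0"
      using \<Theta>U(2)[OF tV[OF that]] ker lin[OF W(2)] by (simp add: x_def linear_scale D_def)
    ultimately show ?thesis by simp
  qed
  have I0: "0 \<in> I" using \<epsilon>(1) by (simp add: I_def)
  have x0: "x 0 = x0" by (simp add: x_def \<Theta>0)
  have "A 0 o\<^sub>L B 0 = B 0"
    by (rule blinfun_eqI) (simp add: A_def x0 \<Psi>'0)
  then have "B 0 = id_blinfun" using AB(1)[OF I0] by simp
  then have "(x has_vector_derivative v) (at 0)" using dx[OF I0] by simp
  then show ?thesis
    using that[of \<epsilon> x] \<epsilon>(1) x0 xW level smx by (simp add: I_def)
qed

section \<open>Fundamental and Cartan tensors\<close>

lemma differentiable_directional_derivative:
  fixes q :: "'a::real_normed_vector \<Rightarrow> real"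
  assumes "q differentiable (at x)"
  shows "((\<lambda>t. q (x + t *\<^sub>R v)) has_real_derivative frechet_derivative q (at x) v) (at 0)"
proof -
  have q: "(q has_derivative frechet_derivative q (at x)) (at (x + 0 *\<^sub>R v))"
    using assms by (simp add: frechet_derivative_works)
  have "((\<lambda>t. x + t *\<^sub>R v) has_derivative (\<lambda>h. h *\<^sub>R v)) (at 0)"
    by (auto intro!: derivative_eq_intros)
  from has_derivative_compose[OF this q]
  have "((\<lambda>t. q (x + t *\<^sub>R v)) has_derivative (\<lambda>h. frechet_derivative q (at x) (h *\<^sub>R v))) (at 0)" .
  moreover have "frechet_derivative q (at x) (h *\<^sub>R v) = frechet_derivative q (at x) v * h" for h
    using linear_frechet_derivative[OF assms] by (simp add: linear_scale)
  ultimately show ?thesis by (simp add: has_field_derivative_def)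
qed

lemma eventually_line_in_open:
  fixes x v :: "'a::real_normed_vector"
  assumes "open S" "x \<in> S"
  shows "\<forall>\<^sub>F t in nhds (0::real). x + t *\<^sub>R v \<in> S"
proof -
  have "((\<lambda>t::real. x + t *\<^sub>R v) \<longlongrightarrow> x + 0 *\<^sub>R v) (nhds 0)"
    by (intro tendsto_intros filterlim_ident)
  with assms show ?thesis by (simp add: tendsto_def)
qed

text \<open>The direction precedes the point, so that \<open>dirderiv q v\<close> is again a
  function and higher derivatives are nested applications.\<close>

definition dirderiv :: "('a::real_normed_vector \<Rightarrow> real) \<Rightarrow> 'a \<Rightarrow> 'a \<Rightarrow> real" where
  "dirderiv q v x = frechet_derivative q (at x) v"

lemma Ck_on_dirderiv: "Ck_on (Suc k) S q \<Longrightarrow> Ck_on k S (dirderiv q v)"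
  by (simp add: dirderiv_def[abs_def])

lemma dirderiv_line:
  assumes "Ck_on (Suc k) S q" "x \<in> S"
  shows "((\<lambda>t. q (x + t *\<^sub>R v)) has_real_derivative dirderiv q v x) (at 0)"
  unfolding dirderiv_def by (rule differentiable_directional_derivative) (use assms in simp)

lemma deriv_line:
  assumes "Ck_on (Suc k) S q" "x \<in> S"
  shows "deriv (\<lambda>t. q (x + t *\<^sub>R v)) 0 = dirderiv q v x"
  by (rule DERIV_imp_deriv[OF dirderiv_line[OF assms]])

lemma dirderiv_add_scale:
  assumes "Ck_on (Suc k) S q" "x \<in> S"
  shows "dirderiv q (v + t *\<^sub>R w) x = dirderiv q v x + t * dirderiv q w x"
proof -
  have "linear (frechet_derivative q (at x))"
    using assms by (intro linear_frechet_derivative) simp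
  then show ?thesis by (simp add: dirderiv_def linear_add linear_scale)
qed

text \<open>Linearity in the inner direction holds at every point of \<open>S\<close>, in particular
  along a short line through \<open>x\<close>, and so survives differentiation along that
  line.\<close>

lemma dirderiv_dirderiv_add_scale:
  assumes S: "open S" and q: "Ck_on (Suc (Suc k)) S q" and x: "x \<in> S"
  shows "dirderiv (dirderiv q (v + t *\<^sub>R w)) u x
    = dirderiv (dirderiv q v) u x + t * dirderiv (dirderiv q w) u x"
proof (rule DERIV_unique)
  show "((\<lambda>s. dirderiv q (v + t *\<^sub>R w) (x + s *\<^sub>R u)) has_real_derivative
      dirderiv (dirderiv q (v + t *\<^sub>R w)) u x) (at 0)"
    by (rule dirderiv_line[OF Ck_on_dirderiv[OF q] x])
  have "((\<lambda>s. dirderiv q v (x + s *\<^sub>R u) + t * dirderiv q w (x + s *\<^sub>R u)) has_real_derivative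
      dirderiv (dirderiv q v) u x + t * dirderiv (dirderiv q w) u x) (at 0)"
    by (intro derivative_intros DERIV_cmult dirderiv_line[OF Ck_on_dirderiv[OF q] x])
  then show "((\<lambda>s. dirderiv q (v + t *\<^sub>R w) (x + s *\<^sub>R u)) has_real_derivative
      dirderiv (dirderiv q v) u x + t * dirderiv (dirderiv q w) u x) (at 0)"
  proof (rule DERIV_cong_ev[OF refl _ refl, THEN iffD2, rotated])
    show "\<forall>\<^sub>F s in nhds 0. dirderiv q (v + t *\<^sub>R w) (x + s *\<^sub>R u)
        = dirderiv q v (x + s *\<^sub>R u) + t * dirderiv q w (x + s *\<^sub>R u)"
      using eventually_line_in_open[OF S x, of u]
      by eventually_elim (rule dirderiv_add_scale[OF q])
  qed
qed

text \<open>All derivatives are moved to the target of \<open>P\<close>, where the square of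
  \<open>F\<close> is regular on \<open>S\<close>. Lines through \<open>P y\<close> stay in
  \<open>S\<close> for small parameters, and \<open>deriv\<close> at 0 sees no others.\<close>

lemma fundamental_tensor_linear:
  assumes S: "open S" and q: "Ck_on 2 S (\<lambda>z. (F z)\<^sup>2)" and P: "linear P" and y: "P y \<in> S"
  shows "fundamental_tensor (\<lambda>z. F (P z)) y u v
    = 1/2 * dirderiv (dirderiv (\<lambda>z. (F z)\<^sup>2) (P v)) (P u) (P y)"
proof -
  let ?q = "\<lambda>z. (F z)\<^sup>2"
  have q: "Ck_on (Suc (Suc 0)) S ?q" using q by (simp add: numeral_2_eq_2 del: Ck_on.simps)
  have "deriv (\<lambda>s. deriv (\<lambda>t. (F (P (y + s *\<^sub>R u + t *\<^sub>R v)))\<^sup>2) 0) 0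
      = deriv (\<lambda>s. dirderiv ?q (P v) (P y + s *\<^sub>R P u)) 0"
  proof (rule deriv_cong_ev[OF _ refl])
    show "\<forall>\<^sub>F s in nhds 0. deriv (\<lambda>t. (F (P (y + s *\<^sub>R u + t *\<^sub>R v)))\<^sup>2) 0
        = dirderiv ?q (P v) (P y + s *\<^sub>R P u)"
      using eventually_line_in_open[OF S y, of "P u"]
      by eventually_elim (simp add: linear_add[OF P] linear_scale[OF P] deriv_line[OF q])
  qed
  also have "\<dots> = dirderiv (dirderiv ?q (P v)) (P u) (P y)"
    by (rule deriv_line[OF Ck_on_dirderiv[OF q] y])
  finally show ?thesis by (simp add: fundamental_tensor_def)
qed

text \<open>The two inner derivatives are twice the fundamental tensor at the shifted point
  \<open>y + r u\<close>, so only the outermost derivative is new.\<close>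

lemma cartan_tensor_linear:
  assumes S: "open S" and q: "Ck_on 3 S (\<lambda>z. (F z)\<^sup>2)" and P: "linear P" and y: "P y \<in> S"
  shows "cartan_tensor (\<lambda>z. F (P z)) y u v w
    = 1/4 * dirderiv (dirderiv (dirderiv (\<lambda>z. (F z)\<^sup>2) (P w)) (P v)) (P u) (P y)"
proof -
  let ?q = "\<lambda>z. (F z)\<^sup>2"
  have q: "Ck_on (Suc (Suc (Suc 0))) S ?q" using q by (simp add: numeral_3_eq_3 del: Ck_on.simps)
  have "deriv (\<lambda>r. deriv (\<lambda>s. deriv (\<lambda>t. (F (P (y + r *\<^sub>R u + s *\<^sub>R v + t *\<^sub>R w)))\<^sup>2) 0) 0) 0
      = deriv (\<lambda>r. dirderiv (dirderiv ?q (P w)) (P v) (P y + r *\<^sub>R P u)) 0"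
  proof (rule deriv_cong_ev[OF _ refl])
    show "\<forall>\<^sub>F r in nhds 0. deriv (\<lambda>s. deriv (\<lambda>t. (F (P (y + r *\<^sub>R u + s *\<^sub>R v + t *\<^sub>R w)))\<^sup>2) 0) 0
        = dirderiv (dirderiv ?q (P w)) (P v) (P y + r *\<^sub>R P u)"
      using eventually_line_in_open[OF S y, of "P u"]
    proof eventually_elim
      case (elim r)
      then have "P (y + r *\<^sub>R u) \<in> S" by (simp add: linear_add[OF P] linear_scale[OF P])
      from fundamental_tensor_linear[OF S _ P this, of F v w] Ck_on_pred[OF q]
      show ?case
        by (simp add: fundamental_tensor_def linear_add[OF P] linear_scale[OF P] numeral_2_eq_2 del: Ck_on.simps)
    qed
  qed
  also have "\<dots> = dirderiv (dirderiv (dirderiv ?q (P w)) (P v)) (P u) (P y)"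
    by (rule deriv_line[OF Ck_on_dirderiv[OF Ck_on_dirderiv[OF q]] y])
  finally show ?thesis by (simp add: cartan_tensor_def)
qed

text \<open>Differentiating the evenness of \<open>q\<close> along the infinitesimal motion \<open>w + t w'\<close>, first in two
  space directions and then in \<open>t\<close>, keeps the derivatives in the order in which the Cartan tensor
  takes them, so that the symmetry of higher derivatives is not needed.\<close>

lemma third_derivative_even:
  fixes q :: "'a::real_normed_vector \<Rightarrow> real"
  assumes S: "open S" and q: "Ck_on 3 S q" and Y: "Y \<in> S"
    and even: "\<And>s r t. Y + s *\<^sub>R U + r *\<^sub>R X \<in> S \<Longrightarrow>
      q ((Y + s *\<^sub>R U + r *\<^sub>R X) + t *\<^sub>R (Y' + s *\<^sub>R U' + r *\<^sub>R X'))
        = q ((Y + s *\<^sub>R U + r *\<^sub>R X) - t *\<^sub>R (Y' + s *\<^sub>R U' + r *\<^sub>R X'))"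
    and stay: "\<And>s t. Y + s *\<^sub>R U \<in> S \<Longrightarrow> (Y + s *\<^sub>R U) + t *\<^sub>R (Y' + s *\<^sub>R U') \<in> S"
  shows "dirderiv (dirderiv (dirderiv q X) U) Y' Y + dirderiv (dirderiv q X) U' Y
    + dirderiv (dirderiv q X') U Y = 0"
proof -
  have q: "Ck_on (Suc (Suc (Suc 0))) S q" using q by (simp add: numeral_3_eq_3 del: Ck_on.simps)
  \<comment> \<open>This is the derivative of \<open>even\<close> in \<open>r\<close> at 0. The
    motion is affine in \<open>r\<close>, so the direction \<open>X\<close> is itself moved to
    \<open>X + t X'\<close>.\<close>
  have first: "dirderiv q (X + t *\<^sub>R X') ((Y + s *\<^sub>R U) + t *\<^sub>R (Y' + s *\<^sub>R U'))
      = dirderiv q (X + (-t) *\<^sub>R X') ((Y + s *\<^sub>R U) + (-t) *\<^sub>R (Y' + s *\<^sub>R U'))"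
    if Ys: "Y + s *\<^sub>R U \<in> S" for s t
  proof (rule DERIV_unique)
    show "((\<lambda>r. q (((Y + s *\<^sub>R U) + t *\<^sub>R (Y' + s *\<^sub>R U')) + r *\<^sub>R (X + t *\<^sub>R X'))) has_real_derivative
        dirderiv q (X + t *\<^sub>R X') ((Y + s *\<^sub>R U) + t *\<^sub>R (Y' + s *\<^sub>R U'))) (at 0)"
      by (rule dirderiv_line[OF q stay[OF Ys]])
    have "((\<lambda>r. q (((Y + s *\<^sub>R U) + (-t) *\<^sub>R (Y' + s *\<^sub>R U')) + r *\<^sub>R (X + (-t) *\<^sub>R X'))) has_real_derivative
        dirderiv q (X + (-t) *\<^sub>R X') ((Y + s *\<^sub>R U) + (-t) *\<^sub>R (Y' + s *\<^sub>R U'))) (at 0)"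
      by (rule dirderiv_line[OF q stay[OF Ys]])
    then show "((\<lambda>r. q (((Y + s *\<^sub>R U) + t *\<^sub>R (Y' + s *\<^sub>R U')) + r *\<^sub>R (X + t *\<^sub>R X'))) has_real_derivative
        dirderiv q (X + (-t) *\<^sub>R X') ((Y + s *\<^sub>R U) + (-t) *\<^sub>R (Y' + s *\<^sub>R U'))) (at 0)"
    proof (rule DERIV_cong_ev[OF refl _ refl, THEN iffD2, rotated])
      show "\<forall>\<^sub>F r in nhds 0. q (((Y + s *\<^sub>R U) + t *\<^sub>R (Y' + s *\<^sub>R U')) + r *\<^sub>R (X + t *\<^sub>R X'))
          = q (((Y + s *\<^sub>R U) + (-t) *\<^sub>R (Y' + s *\<^sub>R U')) + r *\<^sub>R (X + (-t) *\<^sub>R X'))"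
        using eventually_line_in_open[OF S Ys, of X]
      proof eventually_elim
        case (elim r)
        show ?case using even[OF elim, of t] by (simp add: algebra_simps)
      qed
    qed
  qed
  \<comment> \<open>The mixed second derivative at the moved point in the moved directions; it is
    even in \<open>t\<close> by differentiating \<open>first\<close> in \<open>s\<close> at
    0.\<close>
  define \<psi> where "\<psi> = (\<lambda>t. dirderiv (dirderiv q (X + t *\<^sub>R X')) (U + t *\<^sub>R U') (Y + t *\<^sub>R Y'))"
  have Yt: "Y + t *\<^sub>R Y' \<in> S" for t using stay[of 0 t] Y by simp
  have even\<psi>: "\<psi> t = \<psi> (- t)" for t
    unfolding \<psi>_def
  proof (rule DERIV_unique)
    show "((\<lambda>s. dirderiv q (X + t *\<^sub>R X') ((Y + t *\<^sub>R Y') + s *\<^sub>R (U + t *\<^sub>R U'))) has_real_derivative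
        dirderiv (dirderiv q (X + t *\<^sub>R X')) (U + t *\<^sub>R U') (Y + t *\<^sub>R Y')) (at 0)"
      by (rule dirderiv_line[OF Ck_on_dirderiv[OF q] Yt])
    have "((\<lambda>s. dirderiv q (X + (-t) *\<^sub>R X') ((Y + (-t) *\<^sub>R Y') + s *\<^sub>R (U + (-t) *\<^sub>R U'))) has_real_derivative
        dirderiv (dirderiv q (X + (-t) *\<^sub>R X')) (U + (-t) *\<^sub>R U') (Y + (-t) *\<^sub>R Y')) (at 0)"
      by (rule dirderiv_line[OF Ck_on_dirderiv[OF q] Yt])
    then show "((\<lambda>s. dirderiv q (X + t *\<^sub>R X') ((Y + t *\<^sub>R Y') + s *\<^sub>R (U + t *\<^sub>R U'))) has_real_derivative
        dirderiv (dirderiv q (X + (-t) *\<^sub>R X')) (U + (-t) *\<^sub>R U') (Y + (-t) *\<^sub>R Y')) (at 0)"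
    proof (rule DERIV_cong_ev[OF refl _ refl, THEN iffD2, rotated])
      show "\<forall>\<^sub>F s in nhds 0. dirderiv q (X + t *\<^sub>R X') ((Y + t *\<^sub>R Y') + s *\<^sub>R (U + t *\<^sub>R U'))
          = dirderiv q (X + (-t) *\<^sub>R X') ((Y + (-t) *\<^sub>R Y') + s *\<^sub>R (U + (-t) *\<^sub>R U'))"
        using eventually_line_in_open[OF S Y, of U]
      proof eventually_elim
        case (elim s)
        show ?case using first[OF elim, of t] by (simp add: algebra_simps)
      qed
    qed
  qed
  let ?D = "\<lambda>v u. dirderiv (dirderiv q v) u"
  let ?d = "?D X U"
  \<comment> \<open>In this expansion the terms linear in \<open>t\<close> contribute their
    coefficients to the derivative at 0, the quadratic term contributes nothing, and the leading
    term contributes the third derivative.\<close>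
  have \<psi>_eq: "\<psi> t = ?d (Y + t *\<^sub>R Y') + t * ?D X U' (Y + t *\<^sub>R Y')
      + t * (?D X' U (Y + t *\<^sub>R Y') + t * ?D X' U' (Y + t *\<^sub>R Y'))" for t
    unfolding \<psi>_def
    by (simp only: dirderiv_dirderiv_add_scale[OF S q Yt] dirderiv_add_scale[OF Ck_on_dirderiv[OF q] Yt])
      (simp add: distrib_left)
  note line = dirderiv_line[OF Ck_on_dirderiv[OF Ck_on_dirderiv[OF q]] Y, of _ _ Y']
  have d\<psi>: "(\<psi> has_real_derivative dirderiv ?d Y' Y + ?D X U' Y + ?D X' U Y) (at 0)"
    unfolding \<psi>_eq[abs_def]
    by (rule derivative_eq_intros line refl | simp)+
  have "((\<lambda>t. \<psi> (- t)) has_real_derivative - (dirderiv ?d Y' Y + ?D X U' Y + ?D X' U Y)) (at 0)"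
    using DERIV_mirror[of \<psi> _ 0] d\<psi> by simp
  then have "(\<psi> has_real_derivative - (dirderiv ?d Y' Y + ?D X U' Y + ?D X' U Y)) (at 0)"
    by (simp flip: even\<psi>)
  from DERIV_unique[OF d\<psi> this] show ?thesis by simp
qed

text \<open>\<open>P\<close> stands for the identification of \<open>\<mm>\<close> with
  \<open>T\<^sub>o(G/H)\<close> and \<open>B\<close> for \<open>[z, \<cdot>]\<^sub>\<mm>\<close>. Linearity of \<open>B\<close> need not be assumed: a map that is
  skew-adjoint for a definite form is linear.\<close>

lemma skew_map_infinitesimal_isometry:
  fixes F :: "'f::euclidean_space \<Rightarrow> real" and P :: "'e::real_normed_vector \<Rightarrow> 'f" and g :: "'f \<Rightarrow> 'f \<Rightarrow> real"
  assumes q: "Ck_on 3 (UNIV - {0}) (\<lambda>z. (F z)\<^sup>2)"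
    and P: "linear P" and m: "subspace \<mm>" and inj: "\<And>u. u \<in> \<mm> \<Longrightarrow> P u = 0 \<Longrightarrow> u = 0"
    and g: "bilinear g" "\<And>u v. g u v = g v u" "\<And>v. v \<noteq> 0 \<Longrightarrow> g v v > 0"
    and dec: "direct_decomposition UNIV V1 V2" "\<And>u v. u \<in> V1 \<Longrightarrow> v \<in> V2 \<Longrightarrow> g u v = 0"
    and F: "\<And>y1 y2. y1 \<in> V1 \<Longrightarrow> y2 \<in> V2 \<Longrightarrow> y1 + y2 \<noteq> 0 \<Longrightarrow>
      F (y1 + y2) = f (sqrt (g y1 y1), sqrt (g y2 y2))"
    and Bm: "\<And>u. u \<in> \<mm> \<Longrightarrow> B u \<in> \<mm>" and BV: "\<And>u. u \<in> \<mm> \<Longrightarrow> P (B u) \<in> V1"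
    and skew: "\<And>u v. u \<in> \<mm> \<Longrightarrow> v \<in> \<mm> \<Longrightarrow> g (P (B u)) (P v) + g (P u) (P (B v)) = 0"
    and yux: "y \<in> \<mm>" "u \<in> \<mm>" "x \<in> \<mm>" "y \<noteq> 0"
  shows "fundamental_tensor (\<lambda>z. F (P z)) y u (B x) + fundamental_tensor (\<lambda>z. F (P z)) y (B u) x
    + 2 * cartan_tensor (\<lambda>z. F (P z)) y (B y) u x = 0"
proof -
  note gl = bilinear_ladd[OF g(1)] bilinear_radd[OF g(1)] bilinear_lsub[OF g(1)] bilinear_rsub[OF g(1)]
    bilinear_lmul[OF g(1)] bilinear_rmul[OF g(1)]
  note Pl = linear_add[OF P] linear_diff[OF P] linear_scale[OF P]
  have B_lin: "B (u + s *\<^sub>R v) = B u + s *\<^sub>R B v" if uv: "u \<in> \<mm>" "v \<in> \<mm>" for u v s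
  proof -
    \<comment> \<open>The defect of linearity. Skewness moves \<open>B\<close> onto \<open>d\<close>
      in each pairing with \<open>P d\<close>, leaving expressions linear in the other argument that
      cancel; definiteness then gives \<open>P d = 0\<close>.\<close>
    define d where "d = B (u + s *\<^sub>R v) - (B u + s *\<^sub>R B v)"
    have uv': "u + s *\<^sub>R v \<in> \<mm>" by (intro subspace_add subspace_scale m uv)
    have d: "d \<in> \<mm>"
      unfolding d_def by (intro subspace_add subspace_scale subspace_diff m Bm uv uv')
    have "g (P (B (u + s *\<^sub>R v))) (P d) = - g (P (u + s *\<^sub>R v)) (P (B d))"
      "g (P (B u)) (P d) = - g (P u) (P (B d))" "g (P (B v)) (P d) = - g (P v) (P (B d))"
      using skew[OF uv' d] skew[OF uv(1) d] skew[OF uv(2) d] by simp_all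
    then have "g (P d) (P d) = 0"
      by (subst (1) d_def) (simp add: Pl gl algebra_simps)
    then have "P d = 0" using g(3)[of "P d"] by force
    then show ?thesis using inj[OF d] by (simp add: d_def)
  qed
  have orth: "g (P w) (P (B w)) = 0" if "w \<in> \<mm>" for w
    using skew[OF that that] g(2)[of "P w"] by simp
  \<comment> \<open>Pairing with \<open>P w\<close> removes the motion, as \<open>P (B w)\<close> is
    orthogonal to \<open>P w\<close>. The motion therefore never reaches 0, where \<open>F\<close>
    need not be smooth.\<close>
  have nonzero: "P w + t *\<^sub>R P (B w) \<noteq> 0" if "w \<in> \<mm>" "P w \<noteq> 0" for w t
  proof
    assume "P w + t *\<^sub>R P (B w) = 0"
    then have "g (P w) (P w + t *\<^sub>R P (B w)) = 0" using bilinear_rzero[OF g(1)] by simp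
    with g(3)[OF that(2)] orth[OF that(1)] show False by (simp add: gl)
  qed
  have even: "F (P w + t *\<^sub>R P (B w)) = F (P w - t *\<^sub>R P (B w))" if w: "w \<in> \<mm>" "P w \<noteq> 0" for w t
  proof -
    obtain y1 y2 where y: "y1 \<in> V1" "y2 \<in> V2" "P w = y1 + y2"
      using dec(1) unfolding direct_decomposition_def by blast
    define b where "b = P (B w)"
    have b: "b \<in> V1" using BV[OF w(1)] by (simp add: b_def)
    have "g y1 b = 0"
      using orth[OF w(1)] dec(2)[OF b y(2)] g(2)[of b y2] by (simp add: y(3) b_def gl)
    then have norm_eq: "g (y1 + s *\<^sub>R b) (y1 + s *\<^sub>R b) = g y1 y1 + s * s * g b b" for s
      using g(2)[of b y1] by (simp add: gl)
    have V1: "y1 + s *\<^sub>R b \<in> V1" for s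
      using dec(1) unfolding direct_decomposition_def by (intro subspace_add subspace_scale y b) auto
    have "F (P w + s *\<^sub>R b) = f (sqrt (g y1 y1 + s * s * g b b), sqrt (g y2 y2))" for s
      using F[OF V1 y(2), of s] nonzero[OF w, of s]
      by (simp add: norm_eq y(3) algebra_simps flip: b_def)
    from this[of t] this[of "-t"] show ?thesis by (simp add: b_def)
  qed
  have S: "open (UNIV - {0::'f})" by (simp add: open_Diff)
  have Py: "P y \<in> UNIV - {0}" using inj yux by auto
  let ?D = "dirderiv (\<lambda>z. (F z)\<^sup>2)"
  have "dirderiv (dirderiv (?D (P x)) (P u)) (P (B y)) (P y) + dirderiv (?D (P x)) (P (B u)) (P y)
      + dirderiv (?D (P (B x))) (P u) (P y) = 0"
  proof (rule third_derivative_even[OF S q Py])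
    fix s r t :: real
    have mem: "y + s *\<^sub>R u + r *\<^sub>R x \<in> \<mm>" "y + s *\<^sub>R u \<in> \<mm>"
      by (intro subspace_add subspace_scale m yux)+
    show "(F (P y + s *\<^sub>R P u + r *\<^sub>R P x + t *\<^sub>R (P (B y) + s *\<^sub>R P (B u) + r *\<^sub>R P (B x))))\<^sup>2
        = (F (P y + s *\<^sub>R P u + r *\<^sub>R P x - t *\<^sub>R (P (B y) + s *\<^sub>R P (B u) + r *\<^sub>R P (B x))))\<^sup>2"
      if "P y + s *\<^sub>R P u + r *\<^sub>R P x \<in> UNIV - {0}"
      using even[OF mem(1), of t] that by (simp add: B_lin mem yux Pl)
    show "P y + s *\<^sub>R P u + t *\<^sub>R (P (B y) + s *\<^sub>R P (B u)) \<in> UNIV - {0}"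
      if "P y + s *\<^sub>R P u \<in> UNIV - {0}"
      using nonzero[OF mem(2), of t] that by (simp add: B_lin yux Pl)
  qed
  moreover have "Ck_on 2 (UNIV - {0}) (\<lambda>z. (F z)\<^sup>2)"
    using Ck_on_pred[of 2] q by (simp add: eval_nat_numeral del: Ck_on.simps)
  \<comment> \<open>Each fundamental tensor carries the factor 1/2 and the Cartan term
    \<open>2 * 1/4\<close>, so the claim is half of the identity for the derivatives.\<close>
  ultimately show ?thesis
    by (simp add: fundamental_tensor_linear[OF S _ P Py] cartan_tensor_linear[OF S q P Py])
qed

section \<open>Homogeneous manifolds\<close>

lemma homeomorphic_chart:
  assumes "smooth_manifold X" "c \<in> atlas X"
  shows "homeomorphic_map (subtopology (mtop X) (fst c)) (top_of_set (snd c ` fst c)) (snd c)"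
    and "openin (mtop X) (fst c)" and "open (snd c ` fst c)"
  using assms unfolding smooth_manifold_def by blast+

lemma inj_on_chart:
  assumes "smooth_manifold X" "c \<in> atlas X"
  shows "inj_on (snd c) (fst c)"
  using homeomorphic_imp_injective_map[OF homeomorphic_chart(1)[OF assms]]
    openin_subset[OF homeomorphic_chart(2)[OF assms]]
  by (simp add: Int_absorb1)

lemma open_chart_image:
  assumes "smooth_manifold X" "c \<in> atlas X" "openin (mtop X) U"
  shows "open (snd c ` (fst c \<inter> U))"
proof -
  have "openin (subtopology (mtop X) (fst c)) (fst c \<inter> U)"
    using assms(3) by (auto simp: openin_subtopology)
  then have "openin (top_of_set (snd c ` fst c)) (snd c ` (fst c \<inter> U))"
    using homeomorphic_imp_open_map[OF homeomorphic_chart(1)[OF assms(1,2)]] by (simp add: open_map_def)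
  then show ?thesis using homeomorphic_chart(3)[OF assms(1,2)] openin_open_trans by blast
qed

text \<open>The transition from the preferred chart to itself is the identity on an open set around
  the point, so fibre coordinates at \<open>p\<close> need no conversion.\<close>

lemma from_coord_chart_at:
  assumes X: "smooth_manifold X" and p: "p \<in> topspace (mtop X)"
  shows "from_coord X (chart_at X p) p v = v"
proof -
  let ?c = "chart_at X p"
  have c: "?c \<in> atlas X" "p \<in> fst ?c" using X p by (auto simp: smooth_manifold_def)
  have "((snd ?c \<circ> chart_inv ?c) has_derivative (\<lambda>v. v)) (at (snd ?c p))"
    by (rule has_derivative_transform_within_open[OF has_derivative_ident homeomorphic_chart(3)[OF X c(1)]])
      (use c(2) in \<open>auto simp: f_inv_into_f\<close>)
  from frechet_derivative_at[OF this, symmetric] show ?thesis by (simp add: from_coord_def)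
qed

text \<open>In charts the isotropy map is the differential of a submersion whose fibre through the
  identity lies in \<open>H\<close>. A kernel vector is the velocity of a curve in that fibre, which
  is how \<open>subgroup_algebra\<close> is defined.\<close>

lemma isotropy_map_linear_kernel:
  fixes X :: "('g, 'e::euclidean_space) charted_space"
    and M :: "('g set, 'f::euclidean_space) charted_space"
  assumes G: "lie_group G X" and H: "subgroup H G" and M: "homogeneous_manifold G X H M"
  shows "linear (isotropy_map G X H M)"
    and "isotropy_map G X H M v = 0 \<Longrightarrow> v \<in> subgroup_algebra G X H"
proof -
  interpret group G using G by (simp add: lie_group_def)
  have X: "smooth_manifold X" and topX: "topspace (mtop X) = carrier G"
    using G by (auto simp: lie_group_def)
  have mM: "smooth_manifold M" and topM: "topspace (mtop M) = lcosets\<^bsub>G\<^esub> H"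
    using M by (auto simp: homogeneous_manifold_def)
  define \<pi> where "\<pi> = (\<lambda>a. a <#\<^bsub>G\<^esub> H)"
  have \<pi>: "smooth_submersion X M \<pi>" using M by (simp add: homogeneous_manifold_def \<pi>_def)
  have \<pi>1: "\<pi> \<one>\<^bsub>G\<^esub> = H"
    using subgroup.subset[OF H] by (simp add: \<pi>_def lcos_mult_one)
  have "H \<in> topspace (mtop M)"
    unfolding topM LCOSETS_def using \<pi>1 by (auto simp: \<pi>_def)
  define c where "c = chart_at X \<one>\<^bsub>G\<^esub>"
  define d where "d = chart_at M H"
  have c: "c \<in> atlas X" "\<one>\<^bsub>G\<^esub> \<in> fst c"
    using X topX by (auto simp: smooth_manifold_def c_def)
  have d: "d \<in> atlas M" "H \<in> fst d"
    using mM \<open>H \<in> topspace (mtop M)\<close> by (auto simp: smooth_manifold_def d_def)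
  note inj_c = inj_on_chart[OF X c(1)] and inj_d = inj_on_chart[OF mM d(1)]
  define \<phi> where "\<phi> = snd d \<circ> \<pi> \<circ> chart_inv c"
  \<comment> \<open>Restricting to points that project into the domain of \<open>d\<close> keeps
    away from the arbitrary values of its coordinate map.\<close>
  define W where "W = snd c ` {p \<in> fst c. \<pi> p \<in> fst d}"
  define x0 where "x0 = snd c \<one>\<^bsub>G\<^esub>"
  have iso: "isotropy_map G X H M = frechet_derivative \<phi> (at x0)"
    by (rule ext) (simp add: isotropy_map_def tangent_map_def \<pi>_def[symmetric] \<pi>1 c_def d_def \<phi>_def x0_def)
  have x0W: "x0 \<in> W" using c d \<pi>1 by (auto simp: W_def x0_def)
  have cont: "continuous_map (mtop X) (mtop M) \<pi>" and smooth: "smooth_on W \<phi>"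
    using \<pi> c d by (auto simp: smooth_submersion_def smooth_map_def W_def \<phi>_def)
  have "openin (mtop X) {p \<in> topspace (mtop X). \<pi> p \<in> fst d}"
    by (rule openin_continuous_map_preimage[OF cont homeomorphic_chart(2)[OF mM d(1)]])
  from open_chart_image[OF X c(1) this]
  have "open (snd c ` (fst c \<inter> {p \<in> topspace (mtop X). \<pi> p \<in> fst d}))" .
  moreover have "fst c \<inter> {p \<in> topspace (mtop X). \<pi> p \<in> fst d} = {p \<in> fst c. \<pi> p \<in> fst d}"
    using openin_subset[OF homeomorphic_chart(2)[OF X c(1)]] by auto
  ultimately have W: "open W" by (simp add: W_def)
  have "surj (tangent_map X M \<pi> \<one>\<^bsub>G\<^esub>)"
    using \<pi> topX by (simp add: smooth_submersion_def)
  then have surj: "surj (frechet_derivative \<phi> (at x0))"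
    unfolding iso[symmetric] isotropy_map_def \<pi>_def .
  have "Ck_on (Suc 0) W \<phi>" using smooth unfolding smooth_on_def by blast
  from Ck_on_SucD[OF this x0W] show "linear (isotropy_map G X H M)"
    unfolding iso by (rule has_derivative_linear)
  assume "isotropy_map G X H M v = 0"
  then have ker: "frechet_derivative \<phi> (at x0) v = 0" by (simp add: iso)
  obtain x :: "real \<Rightarrow> 'e" and \<epsilon> where \<epsilon>: "\<epsilon> > 0" and x: "x 0 = x0"
    "\<And>t. t \<in> {-\<epsilon><..<\<epsilon>} \<Longrightarrow> x t \<in> W \<and> \<phi> (x t) = \<phi> x0"
    "smooth_on {-\<epsilon><..<\<epsilon>} x" "(x has_vector_derivative v) (at 0)"
    by (rule submersion_level_curve[OF W x0W smooth surj ker]) blast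
  define \<gamma> where "\<gamma> = chart_inv c \<circ> x"
  have \<gamma>: "\<gamma> t \<in> fst c" "\<pi> (\<gamma> t) \<in> fst d" "snd c (\<gamma> t) = x t" if t: "t \<in> {-\<epsilon><..<\<epsilon>}" for t
  proof -
    obtain p where p: "p \<in> fst c" "\<pi> p \<in> fst d" "x t = snd c p"
      using x(2)[OF t] by (auto simp: W_def)
    have "\<gamma> t = p" using p inj_c by (simp add: \<gamma>_def)
    then show "\<gamma> t \<in> fst c" "\<pi> (\<gamma> t) \<in> fst d" "snd c (\<gamma> t) = x t" using p by auto
  qed
  have \<gamma>0: "\<gamma> 0 = \<one>\<^bsub>G\<^esub>" using inj_c c by (simp add: \<gamma>_def x(1) x0_def)
  \<comment> \<open>Coordinates separate points only inside the chart domain, whence the use of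
    \<open>\<gamma>(2)\<close>. Once the coset of \<open>\<gamma> t\<close> is \<open>H\<close>, the
    point lies in \<open>H\<close> because it lies in its own coset.\<close>
  have \<gamma>H: "\<gamma> t \<in> H" if t: "t \<in> {-\<epsilon><..<\<epsilon>}" for t
  proof -
    have "snd d (\<pi> (\<gamma> t)) = snd d H"
      using x(2)[OF t] \<gamma>0 \<pi>1 by (simp add: \<phi>_def \<gamma>_def x(1))
    then have "\<pi> (\<gamma> t) = H" using inj_d \<gamma>(2)[OF t] d(2) by (auto dest: inj_onD)
    moreover have "\<gamma> t \<in> carrier G"
      using \<gamma>(1)[OF t] openin_subset[OF homeomorphic_chart(2)[OF X c(1)]] topX by auto
    ultimately show ?thesis using lcos_self[OF _ H] by (auto simp: \<pi>_def)
  qed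
  have I: "open {-\<epsilon><..<\<epsilon>}" "0 \<in> {-\<epsilon><..<\<epsilon>}" using \<epsilon> by auto
  have eq: "x t = (snd c \<circ> \<gamma>) t" if "t \<in> {-\<epsilon><..<\<epsilon>}" for t using \<gamma>(3)[OF that] by simp
  have "smooth_on {-\<epsilon><..<\<epsilon>} (snd c \<circ> \<gamma>)"
    using x(3) Ck_on_cong[OF I(1), of x "snd c \<circ> \<gamma>"] eq unfolding smooth_on_def by blast
  moreover have "((snd c \<circ> \<gamma>) has_vector_derivative v) (at 0)"
    by (rule has_vector_derivative_transform_within_open[OF x(4) I eq])
  ultimately show "v \<in> subgroup_algebra G X H"
    unfolding subgroup_algebra_def c_def[symmetric] using \<epsilon> \<gamma>0 \<gamma>(1) \<gamma>H by blast
qed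

text \<open>The description operator in \<open>component\<close> is justified by uniqueness: two
  candidates differ by an element of both \<open>A\<close> and \<open>B\<close>.\<close>

lemma component_direct_decomposition:
  assumes "direct_decomposition UNIV A B"
  shows "component A B v \<in> B" and "a \<in> A \<Longrightarrow> b \<in> B \<Longrightarrow> component A B (a + b) = b"
proof -
  have sub: "subspace A" "subspace B" and AB: "A \<inter> B = {0}" and sum: "UNIV = {a + b |a b. a \<in> A \<and> b \<in> B}"
    using assms by (auto simp: direct_decomposition_def)
  show eq: "component A B (a + b) = b" if "a \<in> A" "b \<in> B" for a b
    unfolding component_def
  proof (rule the_equality)
    fix b' assume b': "b' \<in> B \<and> a + b - b' \<in> A"
    then have "(a + b - b') - a \<in> A" "b - b' \<in> B"
      using that sub subspace_diff by blast+
    moreover have "(a + b - b') - a = b - b'" by simp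
    ultimately have "b - b' \<in> A \<inter> B" by simp
    then show "b' = b" using AB by simp
  qed (use that in simp)
  obtain a b where "a \<in> A" "b \<in> B" "v = a + b" using sum by blast
  with eq show "component A B v \<in> B" by simp
qed

text \<open>Smoothness of \<open>F\<close> is stated jointly in base and fibre coordinates;
  composing with the affine inclusion of the fibre over \<open>p\<close> isolates the fibre
  variable.\<close>

lemma finsler_metric_Ck_on_fibre:
  fixes M :: "('p, 'f::euclidean_space) charted_space"
  assumes M: "smooth_manifold M" and F: "finsler_metric M F" and p: "p \<in> topspace (mtop M)"
  shows "Ck_on k (UNIV - {0}) (\<lambda>y. (F p y)\<^sup>2)"
proof -
  let ?d = "chart_at M p" and ?S = "UNIV - {0::'f}"
  have d: "?d \<in> atlas M" "p \<in> fst ?d" using M p by (auto simp: smooth_manifold_def)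
  have S: "open ?S" by (simp add: open_Diff)
  define \<Phi> where "\<Phi> = (\<lambda>(x, y). F (chart_inv ?d x) (from_coord M ?d (chart_inv ?d x) y))"
  have \<Phi>: "Ck_on k (snd ?d ` fst ?d \<times> ?S) \<Phi>"
    using F d(1) by (simp add: finsler_metric_def smooth_on_def \<Phi>_def)
  have lin: "bounded_linear (\<lambda>y::'f. (0::'f, y))"
    by (intro bounded_linear_Pair bounded_linear_zero bounded_linear_ident)
  have "Ck_on k ?S (\<lambda>y. (snd ?d p, 0) + (0::'f, y))"
    by (intro Ck_on_add[OF S Ck_on_const] Ck_on_bounded_linear[OF S lin Ck_on_ident])
  then have "Ck_on k ?S (\<lambda>y. (snd ?d p, y))" by simp
  from Ck_on_compose[OF S \<Phi> this] have "Ck_on k ?S (\<lambda>y. \<Phi> (snd ?d p, y))"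
    using d(2) by auto
  moreover have "\<Phi> (snd ?d p, y) = F p y" for y
    using inj_on_chart[OF M d(1)] d(2) by (simp add: \<Phi>_def from_coord_chart_at[OF M p])
  ultimately have "Ck_on k ?S (F p)" by simp
  from Ck_on_bilinear[OF S bounded_bilinear_mult this this] show ?thesis
    by (simp add: power2_eq_square)
qed

section \<open>Reduction to the tangent space at the base point\<close>

theorem theorem3p1:
  fixes G :: "('g, 'z) monoid_scheme"
    and X :: "('g, 'e::euclidean_space) charted_space"
    and H :: "'g set"
    and M :: "('g set, 'f::euclidean_space) charted_space"
    and \<mm> \<mm>1 \<mm>2 :: "'e set"
    and g :: "'g set \<Rightarrow> 'f \<Rightarrow> 'f \<Rightarrow> real"
    and F :: "'g set \<Rightarrow> 'f \<Rightarrow> real"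
    and V1 V2 :: "'g set \<Rightarrow> 'f set"
  assumes "lie_group G X"
    and "closed_subgroup G X H"
    and "homogeneous_manifold G X H M"
    and "reductive_decomposition G X H \<mm>"
    and "alpha12_metric M F g V1 V2"
    and "invariant_function G M F"
    and "invariant_bilinear G M g"
    and "invariant_distribution G M V1"
    and "invariant_distribution G M V2"
    and "\<mm>1 = {u \<in> \<mm>. isotropy_map G X H M u \<in> V1 H}"
    and "\<mm>2 = {u \<in> \<mm>. isotropy_map G X H M u \<in> V2 H}"
    and "naturally_reductive_riemannian G X H M g \<mm>"
    and "derived_algebra G X \<subseteq> {a + b |a b. a \<in> subgroup_algebra G X H \<and> b \<in> \<mm>1}"
  shows "naturally_reductive_finsler G X H M F"
proof -
  let ?P = "isotropy_map G X H M" and ?h = "subgroup_algebra G X H"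
  let ?br = "\<lambda>u v. component ?h \<mm> (lie_bracket G X u v)"
  have H: "subgroup H G" using assms(2) by (simp add: closed_subgroup_def)
  have M: "smooth_manifold M" and topM: "topspace (mtop M) = lcosets\<^bsub>G\<^esub> H"
    using assms(3) by (auto simp: homogeneous_manifold_def)
  interpret group G using assms(1) by (simp add: lie_group_def)
  have HM: "H \<in> topspace (mtop M)"
    unfolding topM LCOSETS_def
    by (intro UN_I[OF one_closed]) (simp add: lcos_mult_one[OF subgroup.subset[OF H]])
  have P: "linear ?P" and kerP: "\<And>v. ?P v = 0 \<Longrightarrow> v \<in> ?h"
    using isotropy_map_linear_kernel[OF assms(1) H assms(3)] by auto
  have dec: "direct_decomposition UNIV ?h \<mm>"
    using assms(4) by (simp add: reductive_decomposition_def)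
  \<comment> \<open>A vector of \<mm> killed by the isotropy map lies in the subalgebra of
    \<open>H\<close> as well, and the sum is direct.\<close>
  have m: "subspace \<mm>" and inj: "\<And>u. u \<in> \<mm> \<Longrightarrow> ?P u = 0 \<Longrightarrow> u = 0"
    using dec kerP by (auto simp: direct_decomposition_def)
  have F: "finsler_metric M F" and g: "riemannian_metric M g"
    and V: "direct_decomposition UNIV (V1 H) (V2 H)" "\<And>u v. u \<in> V1 H \<Longrightarrow> v \<in> V2 H \<Longrightarrow> g H u v = 0"
    using assms(5) HM unfolding alpha12_metric_def by simp_all
  obtain f where "\<forall>p\<in>topspace (mtop M). \<forall>y1\<in>V1 p. \<forall>y2\<in>V2 p. y1 + y2 \<noteq> 0 \<longrightarrow>
      F p (y1 + y2) = f (sqrt (g p y1 y1), sqrt (g p y2 y2))"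
    using assms(5) unfolding alpha12_metric_def by (elim conjE exE) (rule that, assumption)
  with HM have f: "F H (y1 + y2) = f (sqrt (g H y1 y1), sqrt (g H y2 y2))"
    if "y1 \<in> V1 H" "y2 \<in> V2 H" "y1 + y2 \<noteq> 0" for y1 y2
    using that by blast
  have gH: "bilinear (g H)" "\<And>u v. g H u v = g H v u" "\<And>v. v \<noteq> 0 \<Longrightarrow> g H v v > 0"
    using g HM by (auto simp: riemannian_metric_def)
  \<comment> \<open>By uniqueness of components, the \<mm>-part of a bracket is its \<mm>1-summand,
    which the isotropy map sends into \<open>V1 H\<close>.\<close>
  have brV: "?P (?br z u) \<in> V1 H" for z u
  proof -
    have "lie_bracket G X z u \<in> derived_algebra G X"
      unfolding derived_algebra_def by (rule span_base) auto
    then obtain a b where "lie_bracket G X z u = a + b" "a \<in> ?h" "b \<in> \<mm>1" using assms(13) by blast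
    with component_direct_decomposition(2)[OF dec] show ?thesis using assms(10) by simp
  qed
  have skew: "g H (?P (?br z u)) (?P v) + g H (?P u) (?P (?br z v)) = 0"
    if "z \<in> \<mm>" "u \<in> \<mm>" "v \<in> \<mm>" for z u v
    using assms(12) that by (simp add: naturally_reductive_riemannian_def)
  have "fundamental_tensor (\<lambda>y. F H (?P y)) y u (?br z x) + fundamental_tensor (\<lambda>y. F H (?P y)) y (?br z u) x
      + 2 * cartan_tensor (\<lambda>y. F H (?P y)) y (?br z y) u x = 0"
    if "y \<in> \<mm>" "u \<in> \<mm>" "x \<in> \<mm>" "z \<in> \<mm>" "y \<noteq> 0" for y u x z
  proof (rule skew_map_infinitesimal_isometry[where F = "F H" and P = ?P and B = "?br z" and \<mm> = \<mm>
        and g = "g H" and ?V1.0 = "V1 H" and ?V2.0 = "V2 H" and f = f])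
    show "Ck_on 3 (UNIV - {0}) (\<lambda>y. (F H y)\<^sup>2)" by (rule finsler_metric_Ck_on_fibre[OF M F HM])
    show "?br z u \<in> \<mm>" for u by (rule component_direct_decomposition(1)[OF dec])
    show "g H (?P (?br z u)) (?P v) + g H (?P u) (?P (?br z v)) = 0" if "u \<in> \<mm>" "v \<in> \<mm>" for u v
      by (rule skew[OF \<open>z \<in> \<mm>\<close> that])
  qed (rule P m inj gH V f brV that, (assumption+)?)+
  \<comment> \<open>The witness is the decomposition for which \<open>g\<close> is naturally
    reductive.\<close>
  then have "\<exists>\<mm>. reductive_decomposition G X H \<mm> \<and>
      (\<forall>y\<in>\<mm>. \<forall>u\<in>\<mm>. \<forall>x\<in>\<mm>. \<forall>z\<in>\<mm>. y \<noteq> 0 \<longrightarrow>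
        fundamental_tensor (\<lambda>y. F H (?P y)) y u (component ?h \<mm> (lie_bracket G X z x))
        + fundamental_tensor (\<lambda>y. F H (?P y)) y (component ?h \<mm> (lie_bracket G X z u)) x
        + 2 * cartan_tensor (\<lambda>y. F H (?P y)) y (component ?h \<mm> (lie_bracket G X z y)) u x = 0)"
    by (intro exI[of _ \<mm>] conjI ballI impI assms(4))
  with assms(6) show ?thesis
    unfolding naturally_reductive_finsler_def Let_def by (rule conjI)
qed

end
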